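(* Let $q\neq 2$ be a power of a prime $p$, let $G$ be $\mathrm{SU}_3(q)$ or $\mathrm{PSU}_3(q)$, and let $\mathcal{C}$ be a conjugacy class of non-trivial unipotent elements (i.e. non-trivial $p$-elements) of $G$. Then $K_{\mathcal{C}}$ is irreducible if and only if $\mathcal{C}$ is not a conjugacy class of involutions. If $\mathcal{C}$ is the class of involutions, then $K_{\mathcal{C}}$ is non-degenerate.
   Context: For a finite group $G$ and a subset $\mathcal{C}\subseteq G\setminus\{1\}$ closed under conjugation, the Killing form $K_{\mathcal{C}}$ is the bilinear form on the complex vector space with basis $\mathcal{C}$ given on basis elements by $K_{\mathcal{C}}(a,b)=|C_G(ab)\cap\mathcal{C}|$; it is non-degenerate if the matrix $(K_{\mathcal{C}}(a,b))_{a,b\in\mathcal{C}}$ is invertible. $K_{\mathcal{C}}$ is irreducible if the graph with vertex set $\mathcal{C}$, in which distinct $a,b$ are adjacent iff $C_G(ab)\cap\mathcal{C}\neq\emptyset$, is connected, and reducible otherwise. *)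

theory Defs
  imports "HOL-Algebra.Coset" "HOL-Algebra.Multiplicative_Group" "Jordan_Normal_Form.Determinant"
    "HOL-Computational_Algebra.Primes"
begin

section \<open>Generic notions for a (HOL-Algebra) group G\<close>

definition centralizer_grp :: "('g, 'b) monoid_scheme \<Rightarrow> 'g \<Rightarrow> 'g set" where
  "centralizer_grp G x = {h \<in> carrier G. h \<otimes>\<^bsub>G\<^esub> x = x \<otimes>\<^bsub>G\<^esub> h}"

definition conj_class :: "('g, 'b) monoid_scheme \<Rightarrow> 'g \<Rightarrow> 'g set" where
  "conj_class G x = {h \<otimes>\<^bsub>G\<^esub> x \<otimes>\<^bsub>G\<^esub> inv\<^bsub>G\<^esub> h | h. h \<in> carrier G}"

text \<open>K_C(a,b) = |C_G(ab) \<inter> C|\<close>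
definition killing_form :: "('g, 'b) monoid_scheme \<Rightarrow> 'g set \<Rightarrow> 'g \<Rightarrow> 'g \<Rightarrow> nat" where
  "killing_form G C a b = card (centralizer_grp G (a \<otimes>\<^bsub>G\<^esub> b) \<inter> C)"

text \<open>A fixed enumeration of the finite set C (the choice does not affect invertibility).\<close>
definition enum_set :: "'g set \<Rightarrow> 'g list" where
  "enum_set C = (SOME xs. distinct xs \<and> set xs = C)"

definition killing_matrix :: "('g, 'b) monoid_scheme \<Rightarrow> 'g set \<Rightarrow> complex mat" where
  "killing_matrix G C = (let xs = enum_set C in
     mat (length xs) (length xs) (\<lambda>(i, j). of_nat (killing_form G C (xs ! i) (xs ! j))))"

definition killing_nondegenerate :: "('g, 'b) monoid_scheme \<Rightarrow> 'g set \<Rightarrow> bool" where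
  "killing_nondegenerate G C \<longleftrightarrow> invertible_mat (killing_matrix G C)"

text \<open>Graph on C: distinct a, b adjacent iff C_G(ab) \<inter> C is nonempty.\<close>
definition killing_graph :: "('g, 'b) monoid_scheme \<Rightarrow> 'g set \<Rightarrow> ('g \<times> 'g) set" where
  "killing_graph G C = {(a, b). a \<in> C \<and> b \<in> C \<and> a \<noteq> b \<and>
      centralizer_grp G (a \<otimes>\<^bsub>G\<^esub> b) \<inter> C \<noteq> {}}"

definition killing_irreducible :: "('g, 'b) monoid_scheme \<Rightarrow> 'g set \<Rightarrow> bool" where
  "killing_irreducible G C \<longleftrightarrow> (\<forall>a \<in> C. \<forall>b \<in> C. (a, b) \<in> (killing_graph G C)\<^sup>*)"

section \<open>SU_3(q) and PSU_3(q)\<close>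

text \<open>Over a finite field F of order q^2, with the involutory automorphism x \<mapsto> x^q,
  the unitary group w.r.t. the standard Hermitian form (all nondegenerate Hermitian
  forms are equivalent).\<close>

definition conj_transpose :: "nat \<Rightarrow> 'a::field mat \<Rightarrow> 'a mat" where
  "conj_transpose q A = mat (dim_col A) (dim_row A) (\<lambda>(i, j). (A $$ (j, i)) ^ q)"

definition SU3_carrier :: "nat \<Rightarrow> 'a::field mat set" where
  "SU3_carrier q = {A \<in> carrier_mat 3 3. A * conj_transpose q A = 1\<^sub>m 3 \<and> det A = 1}"

definition SU3 :: "nat \<Rightarrow> 'a::field mat monoid" where
  "SU3 q = \<lparr>carrier = SU3_carrier q, monoid.mult = (*), one = 1\<^sub>m 3\<rparr>"

definition grp_center :: "('g, 'b) monoid_scheme \<Rightarrow> 'g set" where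
  "grp_center G = {z \<in> carrier G. \<forall>h \<in> carrier G. z \<otimes>\<^bsub>G\<^esub> h = h \<otimes>\<^bsub>G\<^esub> z}"

definition PSU3 :: "nat \<Rightarrow> 'a::field mat set monoid" where
  "PSU3 q = SU3 q Mod grp_center (SU3 q)"

end

theory Submission
  imports Defs "HOL-Library.Product_Plus"
begin

text \<open>
  In hyperbolic coordinates, where the Hermitian form is antidiagonal, every nontrivial unipotent
  element is conjugate to an upper unitriangular \<open>u(\<alpha>, \<beta>)\<close> with \<open>\<beta> + \<beta>\<^sup>q = - \<alpha>\<^bsup>q+1\<^esup>\<close>: a transvection if
  \<open>\<alpha> = 0\<close>, a regular unipotent otherwise, and an involution iff \<open>p = 2\<close> and \<open>\<alpha> = 0\<close>.

  Irreducibility. Let \<open>M\<close> be the stabiliser of the component of \<open>c = u(\<alpha>, \<beta>)\<close> in the Killing graph, so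
  that the graph is connected iff \<open>M\<close> is the whole group. All \<open>u(\<xi>, \<eta>)\<close> lie in \<open>M\<close>, because
  \<open>c \<cdot> c\<^sup>u = u(2\<alpha>, \<dots>)\<close> commutes with \<open>c\<close>. By the Bruhat decomposition these elements together with a
  single \<open>A\<close> moving the fixed singular line of \<open>c\<close> generate the group, so it suffices to find one
  edge from \<open>c\<close> to a conjugate with a different fixed line. For transvections and \<open>p\<close> odd, the product
  of two opposite transvections can be made to have eigenvalue \<open>-1\<close> on a singular vector. For regular
  unipotents, an upper and a lower unitriangular element whose product has trace \<open>3\<close> have a unipotent
  product, and the freedom left is used to make it commute with a conjugate of \<open>c\<close>; this requires a
  cube of nonzero trace, which exists iff \<open>q \<noteq> 2\<close>.

  Involutions. For \<open>p = 2\<close> the involutions \<open>a \<noteq> b\<close> have a neighbour commuting with \<open>a b\<close> only if all three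
  commute. So the Killing matrix is block diagonal with several blocks \<open>(|C| - m) I + m J\<close>, which are
  invertible.

  Central quotients are treated simultaneously, since the kernel has exponent dividing \<open>3\<close> and trivial
  \<open>p\<close>-part.
\<close>

section \<open>Nondegeneracy criteria for the Killing form\<close>

lemma invertible_mat_if_kernel_trivial:
  fixes M :: "'a::field mat"
  assumes M: "M \<in> carrier_mat n n"
    and ker: "\<And>v. v \<in> carrier_vec n \<Longrightarrow> M *\<^sub>v v = 0\<^sub>v n \<Longrightarrow> v = 0\<^sub>v n"
  shows "invertible_mat M"
proof -
  have "det M \<noteq> 0"
    using det_0_iff_vec_prod_zero_field[OF M] ker by blast
  then obtain B where "B \<in> carrier_mat n n" "B * M = 1\<^sub>m n" "M * B = 1\<^sub>m n"
    using det_non_zero_imp_unit[OF M, of "()"]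
    by (auto simp: Units_def ring_mat_def)
  then show ?thesis
    using M unfolding invertible_mat_def inverts_mat_def by auto
qed

text \<open>Stating the kernel condition for functions on \<open>C\<close> removes the chosen
  enumeration \<open>enum_set C\<close> from all later arguments.\<close>

lemma killing_nondegenerateI:
  assumes fin: "finite C"
    and ker: "\<And>v. (\<And>a. a \<in> C \<Longrightarrow> (\<Sum>b\<in>C. of_nat (killing_form G C a b) * v b) = (0::complex))
                 \<Longrightarrow> \<forall>a\<in>C. v a = 0"
  shows "killing_nondegenerate G C"
proof -
  define xs where "xs = enum_set C"
  have xs: "distinct xs" "set xs = C"
    using someI_ex[of "\<lambda>xs. distinct xs \<and> set xs = C"] finite_distinct_list[OF fin]
    unfolding xs_def enum_set_def by blast+
  define n where "n = length xs"
  have bij: "bij_betw (\<lambda>i. xs ! i) {0..<n} C"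
    using bij_betw_nth[OF xs(1), of "{0..<n}" C] xs(2)
    by (simp add: n_def atLeast0LessThan)
  define M where "M = killing_matrix G C"
  have M: "M \<in> carrier_mat n n"
    by (simp add: M_def killing_matrix_def Let_def n_def xs_def)
  have "v = 0\<^sub>v n" if v: "v \<in> carrier_vec n" and Mv: "M *\<^sub>v v = 0\<^sub>v n" for v
  proof -
    define f where "f = (\<lambda>a. v $ (the_inv_into {0..<n} (\<lambda>i. xs ! i) a))"
    have f: "f (xs ! i) = v $ i" if "i < n" for i
      using that the_inv_into_f_f[OF bij_betw_imp_inj_on[OF bij], of i] by (simp add: f_def)
    have "\<forall>a\<in>C. f a = 0"
    proof (rule ker)
      fix a assume "a \<in> C"
      then obtain i where i: "i < n" "a = xs ! i"
        using bij by (auto simp: bij_betw_def)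
      have "(\<Sum>b\<in>C. of_nat (killing_form G C a b) * f b)
          = (\<Sum>j\<in>{0..<n}. of_nat (killing_form G C a (xs ! j)) * f (xs ! j))"
        by (rule sum.reindex_bij_betw[OF bij, symmetric])
      also have "\<dots> = (M *\<^sub>v v) $ i"
        using i v M
        by (simp add: scalar_prod_def f M_def killing_matrix_def Let_def n_def flip: xs_def)
      also have "\<dots> = 0" using Mv i by simp
      finally show "(\<Sum>b\<in>C. of_nat (killing_form G C a b) * f b) = 0" .
    qed
    then show ?thesis using f v bij by (auto simp: bij_betw_def intro!: eq_vecI) 
  qed
  then show ?thesis
    unfolding killing_nondegenerate_def M_def[symmetric]
    by (rule invertible_mat_if_kernel_trivial[OF M])
qed

context group begin

text \<open>The hypotheses \<open>tr\<close> and \<open>pr\<close> make the Killing matrix block diagonal, the blocks being the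
  commuting classes of \<open>C\<close>, with every block of the form \<open>(|C| - m) I + m J\<close>.\<close>

lemma killing_involutions:
  assumes fin: "finite C" and sub: "C \<subseteq> carrier G"
    and inv2: "\<And>a. a \<in> C \<Longrightarrow> a \<otimes> a = \<one>"
    and tr: "\<And>a b c. \<lbrakk>a \<in> C; b \<in> C; c \<in> C; a \<otimes> b = b \<otimes> a; b \<otimes> c = c \<otimes> b\<rbrakk> \<Longrightarrow> a \<otimes> c = c \<otimes> a"
    and pr: "\<And>a b c. \<lbrakk>a \<in> C; b \<in> C; c \<in> C; a \<noteq> b; c \<otimes> (a \<otimes> b) = (a \<otimes> b) \<otimes> c\<rbrakk>
                \<Longrightarrow> a \<otimes> b = b \<otimes> a \<and> a \<otimes> c = c \<otimes> a"
    and nc: "\<exists>a\<in>C. \<exists>b\<in>C. a \<otimes> b \<noteq> b \<otimes> a"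
  shows "\<not> killing_irreducible G C" and "killing_nondegenerate G C"
proof -
  show "\<not> killing_irreducible G C"
  proof
    assume irr: "killing_irreducible G C"
    from nc obtain a b where ab: "a \<in> C" "b \<in> C" "a \<otimes> b \<noteq> b \<otimes> a" by blast
    have "(a, b) \<in> (killing_graph G C)\<^sup>*"
      using irr ab by (auto simp: killing_irreducible_def)
    then have "b \<in> C \<and> a \<otimes> b = b \<otimes> a"
    proof (induction rule: rtrancl_induct)
      case (step y z)
      then have "z \<in> C" "y \<in> C" "y \<otimes> z = z \<otimes> y"
        using pr by (auto simp: killing_graph_def centralizer_grp_def)
      then show ?case using step tr ab(1) by blast
    qed (use ab in auto)
    then show False using ab by simp
  qed
  \<comment> \<open>\<open>D a\<close> is the block of \<open>a\<close>: row \<open>a\<close> of the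
    matrix has \<open>card C\<close> on the diagonal, \<open>card (D a)\<close> elsewhere in the
    block and 0 outside it.\<close>
  define D where "D = (\<lambda>a. {c \<in> C. a \<otimes> c = c \<otimes> a})"
  have finD: "finite (D a)" for a using fin by (simp add: D_def)
  have K1: "killing_form G C a a = card C" if "a \<in> C" for a
  proof -
    have "centralizer_grp G (a \<otimes> a) \<inter> C = C"
      using that sub inv2 by (auto simp: centralizer_grp_def)
    then show ?thesis by (simp add: killing_form_def)
  qed
  have K2: "killing_form G C a b = card (D a)" if "a \<in> C" "b \<in> D a" "a \<noteq> b" for a b
  proof -
    have b: "b \<in> C" "a \<otimes> b = b \<otimes> a" using that by (auto simp: D_def)
    have "centralizer_grp G (a \<otimes> b) \<inter> C = D a"
    proof (intro equalityI subsetI)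
      fix c assume "c \<in> centralizer_grp G (a \<otimes> b) \<inter> C"
      then have "c \<in> C" "c \<otimes> (a \<otimes> b) = (a \<otimes> b) \<otimes> c" by (auto simp: centralizer_grp_def)
      with pr[OF that(1) b(1) this(1) that(3)] show "c \<in> D a" by (simp add: D_def)
    next
      fix c assume "c \<in> D a"
      then have c: "c \<in> C" "a \<otimes> c = c \<otimes> a" by (auto simp: D_def)
      have cl: "a \<in> carrier G" "b \<in> carrier G" "c \<in> carrier G" using sub that b c by auto
      have "b \<otimes> c = c \<otimes> b" using tr[of b a c] b c that by simp
      then have "c \<otimes> (a \<otimes> b) = (a \<otimes> b) \<otimes> c"
        using cl c by (metis m_assoc)
      then show "c \<in> centralizer_grp G (a \<otimes> b) \<inter> C"
        using cl c by (auto simp: centralizer_grp_def)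
    qed
    then show ?thesis by (simp add: killing_form_def)
  qed
  have K0: "killing_form G C a b = 0" if "a \<in> C" "b \<in> C" "b \<notin> D a" for a b
  proof -
    have "a \<noteq> b" using that by (auto simp: D_def)
    then have "centralizer_grp G (a \<otimes> b) \<inter> C = {}"
      using pr[OF that(1,2) _ \<open>a \<noteq> b\<close>] that unfolding centralizer_grp_def D_def by blast
    then show ?thesis by (simp add: killing_form_def)
  qed
  have Dself: "a \<in> D a" if "a \<in> C" for a using that by (simp add: D_def)
  have Deq: "D a = D b" if "a \<in> C" "b \<in> D a" for a b
  proof -
    have b: "b \<in> C" "a \<otimes> b = b \<otimes> a" using that by (auto simp: D_def)
    show ?thesis
    proof (intro equalityI subsetI)
      fix c assume "c \<in> D a" then show "c \<in> D b" using tr[of b a c] b that by (auto simp: D_def)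
    next
      fix c assume "c \<in> D b" then show "c \<in> D a" using tr[of a b c] b that by (auto simp: D_def)
    qed
  qed
  \<comment> \<open>By \<open>nc\<close> there are at least two blocks, so the coefficient
    \<open>card C - card (D a)\<close> in \<open>row\<close> is positive.\<close>
  have Dlt: "card (D a) < card C" if a: "a \<in> C" for a
  proof -
    have "D a \<noteq> C"
    proof
      assume "D a = C"
      then have com: "a \<otimes> c = c \<otimes> a" if "c \<in> C" for c using that by (auto simp: D_def)
      have "b \<otimes> c = c \<otimes> b" if "b \<in> C" "c \<in> C" for b c
        using tr[OF that(1) a that(2)] com[OF that(1)] com[OF that(2)] by simp
      then show False using nc by blast
    qed
    then have "D a \<subset> C" by (auto simp: D_def)
    then show ?thesis by (rule psubset_card_mono[OF fin])
  qed
  show "killing_nondegenerate G C"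
  proof (rule killing_nondegenerateI[OF fin])
    fix v :: "'a \<Rightarrow> complex"
    assume v: "\<And>a. a \<in> C \<Longrightarrow> (\<Sum>b\<in>C. of_nat (killing_form G C a b) * v b) = 0"
    define S where "S = (\<lambda>a. \<Sum>b\<in>D a. v b)"
    have row: "(of_nat (card C) - of_nat (card (D a))) * v a + of_nat (card (D a)) * S a = 0"
      if a: "a \<in> C" for a
    proof -
      have "0 = (\<Sum>b\<in>C. of_nat (killing_form G C a b) * v b)" using v[OF a] by simp
      also have "\<dots> = (\<Sum>b\<in>D a. of_nat (killing_form G C a b) * v b)"
        by (rule sum.mono_neutral_right) (use fin K0 a in \<open>auto simp: D_def\<close>)
      also have "\<dots> = of_nat (card C) * v a
          + (\<Sum>b\<in>D a - {a}. of_nat (killing_form G C a b) * v b)"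
        using sum.remove[OF finD Dself[OF a], of "\<lambda>b. of_nat (killing_form G C a b) * v b"]
        by (simp add: K1[OF a])
      also have "(\<Sum>b\<in>D a - {a}. of_nat (killing_form G C a b) * v b)
          = (\<Sum>b\<in>D a - {a}. of_nat (card (D a)) * v b)"
        by (rule sum.cong) (auto simp: K2[OF a])
      also have "\<dots> = of_nat (card (D a)) * (S a - v a)"
        using sum.remove[OF finD Dself[OF a], of v] by (simp add: S_def sum_distrib_left)
      finally show ?thesis by (simp add: algebra_simps)
    qed
    show "\<forall>a\<in>C. v a = 0"
    proof
      fix a assume a: "a \<in> C"
      define d where "d = card C - card (D a)"
      have d: "d > 0" "of_nat (card C) - of_nat (card (D a)) = (of_nat d :: complex)"
        using Dlt[OF a] by (auto simp: d_def of_nat_diff)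
      \<comment> \<open>The sum \<open>S\<close> is the same for all rows of a block, so
        \<open>row\<close> forces a kernel vector to be constant there; its value is then
        annihilated by the positive integer \<open>d + card (D a) * card (D a)\<close>.\<close>
      have "v b = v a" if b: "b \<in> D a" for b
      proof -
        have "b \<in> C" "D b = D a" using b Deq[OF a b] by (auto simp: D_def)
        then have "of_nat d * v b + of_nat (card (D a)) * S a = of_nat d * v a + of_nat (card (D a)) * S a"
          using row[OF a] row[of b] d(2) by (simp add: S_def)
        then have "of_nat d * v b = of_nat d * v a" by (rule add_right_imp_eq)
        then show ?thesis using d(1) by simp
      qed
      then have "S a = of_nat (card (D a)) * v a" by (simp add: S_def)
      then have "of_nat (d + card (D a) * card (D a)) * v a = 0"
        using row[OF a] d(2) by (simp add: algebra_simps)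
      moreover have "d + card (D a) * card (D a) \<noteq> 0" using d(1) by simp
      ultimately show "v a = 0" by (metis mult_eq_0_iff of_nat_eq_0_iff)
    qed
  qed
qed

section \<open>Conjugation and connectivity of the Killing graph\<close>

definition conj_by :: "'a \<Rightarrow> 'a \<Rightarrow> 'a" where
  "conj_by h x = h \<otimes> x \<otimes> inv h"

lemma conj_by_closed [simp]: "h \<in> carrier G \<Longrightarrow> x \<in> carrier G \<Longrightarrow> conj_by h x \<in> carrier G"
  by (simp add: conj_by_def)

lemma conj_by_mult [simp]:
  "\<lbrakk>h \<in> carrier G; x \<in> carrier G; y \<in> carrier G\<rbrakk> \<Longrightarrow> conj_by h (x \<otimes> y) = conj_by h x \<otimes> conj_by h y"
  unfolding conj_by_def by (simp add: m_assoc) (simp add: inv_solve_left m_assoc[symmetric])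

lemma conj_by_conj_by:
  "\<lbrakk>g \<in> carrier G; h \<in> carrier G; x \<in> carrier G\<rbrakk> \<Longrightarrow> conj_by g (conj_by h x) = conj_by (g \<otimes> h) x"
  by (simp add: conj_by_def m_assoc inv_mult_group)

lemma conj_by_one [simp]: "x \<in> carrier G \<Longrightarrow> conj_by \<one> x = x"
  by (simp add: conj_by_def)

lemma conj_by_inv_cancel [simp]:
  "\<lbrakk>h \<in> carrier G; x \<in> carrier G\<rbrakk> \<Longrightarrow> conj_by (inv h) (conj_by h x) = x"
  by (simp add: conj_by_conj_by)

lemma conj_by_eq_iff [simp]:
  "\<lbrakk>h \<in> carrier G; x \<in> carrier G; y \<in> carrier G\<rbrakk> \<Longrightarrow> conj_by h x = conj_by h y \<longleftrightarrow> x = y"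
  by (metis conj_by_inv_cancel)

lemma conj_by_eq_self_iff:
  "\<lbrakk>h \<in> carrier G; x \<in> carrier G\<rbrakk> \<Longrightarrow> conj_by h x = x \<longleftrightarrow> h \<otimes> x = x \<otimes> h"
  unfolding conj_by_def by (metis inv_solve_right m_closed)

lemma conj_class_eq: "conj_class G x = (\<lambda>h. conj_by h x) ` carrier G"
  by (auto simp: conj_class_def conj_by_def)

lemma conj_class_conj_by:
  assumes "x \<in> carrier G" "h \<in> carrier G"
  shows "conj_class G (conj_by h x) = conj_class G x"
proof -
  have "\<exists>k\<in>carrier G. g = k \<otimes> h" if "g \<in> carrier G" for g
    using that assms by (intro bexI[of _ "g \<otimes> inv h"]) (auto simp: m_assoc)
  then show ?thesis
    using assms by (fastforce simp: conj_class_eq conj_by_conj_by image_iff)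
qed

lemma killing_graph_conj_by:
  assumes x: "x \<in> carrier G" and h: "h \<in> carrier G"
    and ab: "(a, b) \<in> killing_graph G (conj_class G x)"
  shows "(conj_by h a, conj_by h b) \<in> killing_graph G (conj_class G x)"
proof -
  let ?C = "conj_class G x"
  have sub: "?C \<subseteq> carrier G" using x by (auto simp: conj_class_eq)
  have cl: "conj_by h y \<in> ?C" if "y \<in> ?C" for y
    using that h x by (auto simp: conj_class_eq conj_by_conj_by)
  obtain c where c: "c \<in> ?C" "c \<otimes> (a \<otimes> b) = (a \<otimes> b) \<otimes> c" and ab': "a \<in> ?C" "b \<in> ?C" "a \<noteq> b"
    using ab by (auto simp: killing_graph_def centralizer_grp_def)
  have car: "a \<in> carrier G" "b \<in> carrier G" "c \<in> carrier G" using ab' c sub by auto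
  have "conj_by h (c \<otimes> (a \<otimes> b)) = conj_by h ((a \<otimes> b) \<otimes> c)" using c by simp
  then have "conj_by h c \<otimes> (conj_by h a \<otimes> conj_by h b) = (conj_by h a \<otimes> conj_by h b) \<otimes> conj_by h c"
    using car h by simp
  moreover have "conj_by h c \<in> carrier G" using car h by simp
  ultimately have "conj_by h c \<in> centralizer_grp G (conj_by h a \<otimes> conj_by h b) \<inter> ?C"
    using cl c by (simp add: centralizer_grp_def)
  then show ?thesis using cl ab' car h by (auto simp: killing_graph_def)
qed

lemma killing_reach_conj_by:
  assumes x: "x \<in> carrier G" and h: "h \<in> carrier G"
    and ab: "(a, b) \<in> (killing_graph G (conj_class G x))\<^sup>*"
  shows "(conj_by h a, conj_by h b) \<in> (killing_graph G (conj_class G x))\<^sup>*"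
  using ab by induction (auto dest: killing_graph_conj_by[OF x h] intro: rtrancl_into_rtrancl)

text \<open>In a finite group the inverse of \<open>a\<close> is its power with exponent
  \<open>ord a - 1\<close>, so closure under products suffices.\<close>

lemma finite_order_inv_closed_subgroup:
  assumes fin: "finite (carrier G)" and sub: "H \<subseteq> carrier G" and ne: "\<one> \<in> H"
    and cl: "\<And>a b. a \<in> H \<Longrightarrow> b \<in> H \<Longrightarrow> a \<otimes> b \<in> H"
  shows "subgroup H G"
proof (rule subgroupI)
  fix a assume a: "a \<in> H"
  then have ac: "a \<in> carrier G" using sub by auto
  have pow: "a [^] n \<in> H" for n :: nat by (induction n) (use a ne cl in auto)
  have "ord a \<ge> 1" using ord_ge_1[OF fin ac] .
  then have "a [^] (ord a - 1) \<otimes> a = \<one>"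
    using pow_ord_eq_1[OF ac] by (metis Suc_diff_le diff_Suc_1 nat_pow_Suc One_nat_def)
  then have "inv a = a [^] (ord a - 1)" using ac by (simp add: inv_equality)
  then show "inv a \<in> H" using pow by simp
qed (use assms in auto)

text \<open>Since \<open>G\<close> acts transitively on the vertices of the Killing graph by automorphisms, the graph
  is connected iff the setwise stabiliser of the component of \<open>x\<close> is everything.\<close>

definition killing_stab :: "'a \<Rightarrow> 'a set" where
  "killing_stab x = {h \<in> carrier G. (x, conj_by h x) \<in> (killing_graph G (conj_class G x))\<^sup>*}"

lemma subgroup_killing_stab:
  assumes fin: "finite (carrier G)" and x: "x \<in> carrier G"
  shows "subgroup (killing_stab x) G"
proof (rule finite_order_inv_closed_subgroup[OF fin])
  fix a b assume ab: "a \<in> killing_stab x" "b \<in> killing_stab x"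
  then have "(conj_by a x, conj_by a (conj_by b x)) \<in> (killing_graph G (conj_class G x))\<^sup>*"
    using killing_reach_conj_by[OF x] by (auto simp: killing_stab_def)
  then show "a \<otimes> b \<in> killing_stab x"
    using ab x by (auto simp: killing_stab_def conj_by_conj_by)
qed (use x in \<open>auto simp: killing_stab_def\<close>)

lemma killing_irreducible_if_stab:
  assumes fin: "finite (carrier G)" and x: "x \<in> carrier G"
    and full: "killing_stab x = carrier G"
  shows "killing_irreducible G (conj_class G x)"
  unfolding killing_irreducible_def
proof (intro ballI)
  fix a b assume "a \<in> conj_class G x" "b \<in> conj_class G x"
  then obtain g h where gh: "g \<in> carrier G" "a = conj_by g x" "h \<in> carrier G" "b = conj_by h x"
    by (auto simp: conj_class_eq)
  have "inv g \<otimes> h \<in> killing_stab x" using gh full by simp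
  then have "(conj_by g x, conj_by g (conj_by (inv g \<otimes> h) x)) \<in> (killing_graph G (conj_class G x))\<^sup>*"
    using killing_reach_conj_by[OF x gh(1)] by (auto simp: killing_stab_def)
  then show "(a, b) \<in> (killing_graph G (conj_class G x))\<^sup>*"
    using gh x by (simp add: conj_by_conj_by m_assoc[symmetric])
qed

text \<open>The element \<open>conj_by k x\<close> of the class witnesses an edge from
  \<open>x\<close> to \<open>conj_by h x\<close>, unless these coincide, when reachability is
  trivial.\<close>

lemma killing_stabI:
  assumes x: "x \<in> carrier G" and h: "h \<in> carrier G" and k: "k \<in> carrier G"
    and comm: "conj_by k x \<otimes> (x \<otimes> conj_by h x) = (x \<otimes> conj_by h x) \<otimes> conj_by k x"
  shows "h \<in> killing_stab x"
proof (cases "conj_by h x = x")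
  case False
  have mem: "conj_by g x \<in> conj_class G x" if "g \<in> carrier G" for g
    using that by (simp add: conj_class_eq)
  have "x \<in> conj_class G x" using mem[of \<one>] x by simp
  moreover have "conj_by k x \<in> centralizer_grp G (x \<otimes> conj_by h x) \<inter> conj_class G x"
    using comm mem[OF k] x k by (simp add: centralizer_grp_def)
  ultimately have "(x, conj_by h x) \<in> killing_graph G (conj_class G x)"
    using False mem[OF h] by (auto simp: killing_graph_def)
  then show ?thesis using h by (auto simp: killing_stab_def)
qed (use h in \<open>simp add: killing_stab_def\<close>)

end

section \<open>Finite fields of square order\<close>

lemma card_power_eq_le:
  fixes c :: "'a::field"
  assumes "m > 0"
  shows "card {x. x ^ m = c} \<le> m"
proof -
  define f where "f = monom 1 m - [:c:]"
  have "coeff f m = 1" using assms by (cases m) (auto simp: f_def)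
  then have "f \<noteq> 0" by auto
  moreover have "degree f \<le> m"
    unfolding f_def by (rule degree_diff_le) (auto simp: degree_monom_le)
  moreover have "{x. x ^ m = c} = {x. poly f x = 0}" by (auto simp: f_def poly_monom)
  ultimately show ?thesis using card_poly_roots_bound[of f] by simp
qed

text \<open>Multiplication by a nonzero \<open>x\<close> permutes the nonzero elements; comparing
  their products before and after gives \<open>x ^ card ?S = 1\<close>.\<close>

lemma finite_field_power_card:
  fixes x :: "'a::field"
  assumes fin: "finite (UNIV :: 'a set)"
  shows "x ^ card (UNIV :: 'a set) = x"
proof (cases "x = 0")
  case False
  let ?S = "UNIV - {0 :: 'a}"
  have "bij_betw ((*) x) ?S ?S"
    by (rule bij_betwI[of _ _ _ "\<lambda>y. y / x"]) (use False in auto)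
  then have "(\<Prod>y\<in>?S. x * y) = (\<Prod>y\<in>?S. y)"
    by (rule prod.reindex_bij_betw)
  then have "x ^ card ?S * (\<Prod>y\<in>?S. y) = (\<Prod>y\<in>?S. y)" by (simp add: prod.distrib)
  moreover have "(\<Prod>y\<in>?S. y) \<noteq> 0" using fin by (simp add: prod_zero_iff)
  ultimately have "x ^ card ?S = 1" by simp
  moreover have "card (UNIV :: 'a set) = Suc (card ?S)" by (rule card.remove[OF fin UNIV_I])
  ultimately show ?thesis by (simp only: power_Suc mult_1_right)
qed (use fin in \<open>simp add: card_gt_0_iff\<close>)

text \<open>Translation by 1 permutes the field, so comparing the sums of all elements shows that
  the order of the field vanishes in it.\<close>

lemma CHAR_of_prime_power_card:
  assumes fin: "finite (UNIV :: 'a::field set)" and p: "prime p"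
    and card: "card (UNIV :: 'a set) = p ^ m"
  shows "CHAR('a) = p"
proof -
  have "(\<Sum>x\<in>(UNIV::'a set). x + 1) = (\<Sum>x\<in>UNIV. x)"
    by (rule sum.reindex_bij_betw) (rule bij_betwI[of _ _ _ "\<lambda>x. x - 1"]; simp)
  then have "of_nat (p ^ m) = (0 :: 'a)" using card by (simp add: sum.distrib)
  then have "CHAR('a) dvd p ^ m" by (simp only: of_nat_eq_0_iff_char_dvd)
  moreover have "prime CHAR('a)" using finite_imp_CHAR_pos[OF fin] by (rule prime_CHAR_semidom)
  ultimately show ?thesis using p by (metis prime_dvd_power primes_dvd_imp_eq)
qed

locale unitary_field =
  fixes p q :: nat and ty :: "'a::field itself"
  assumes finite_UNIV: "finite (UNIV :: 'a set)"
    and p: "prime p" and q_power: "\<exists>n. n \<ge> 1 \<and> q = p ^ n" and q_neq_2: "q \<noteq> 2"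
    and card_UNIV: "card (UNIV :: 'a set) = q ^ 2"
begin

lemma CHAR: "CHAR('a) = p"
proof -
  obtain n where "q = p ^ n" using q_power by auto
  then have "card (UNIV :: 'a set) = p ^ (n * 2)" using card_UNIV by (simp add: power_mult)
  then show ?thesis by (rule CHAR_of_prime_power_card[OF finite_UNIV p])
qed

lemma q_gt_2: "q > 2"
proof -
  obtain n where n: "n \<ge> 1" "q = p ^ n" using q_power by auto
  have "p ^ 1 \<le> p ^ n" using p n by (intro power_increasing) (auto dest: prime_gt_0_nat)
  then show ?thesis using prime_ge_2_nat[OF p] q_neq_2 n by simp
qed

text \<open>The field automorphism of order two, in the part of complex conjugation; its fixed
  points form the subfield of order \<open>q\<close>.\<close>

definition cj :: "'a \<Rightarrow> 'a" where "cj x = x ^ q"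

lemma cj_add [simp]: "cj (x + y) = cj x + cj y"
proof -
  obtain n where "q = p ^ n" using q_power by auto
  then show ?thesis
    unfolding cj_def using freshmans_dream'[of q n x y] CHAR p by simp
qed

lemma cj_0 [simp]: "cj 0 = 0" using q_gt_2 by (simp add: cj_def)
lemma cj_1 [simp]: "cj 1 = 1" by (simp add: cj_def)
lemma cj_mult [simp]: "cj (x * y) = cj x * cj y" by (simp add: cj_def power_mult_distrib)
lemma cj_minus [simp]: "cj (- x) = - cj x"
  by (metis add_eq_0_iff cj_0 cj_add add.right_inverse)
lemma cj_diff [simp]: "cj (x - y) = cj x - cj y"
  using cj_add[of x "- y"] by simp
lemma cj_divide [simp]: "cj (x / y) = cj x / cj y" by (simp add: cj_def power_divide)
lemma cj_power [simp]: "cj (x ^ k) = cj x ^ k" by (simp add: cj_def flip: power_mult) (simp add: mult.commute)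
lemma cj_of_nat [simp]: "cj (of_nat k) = of_nat k" by (induction k) auto
lemma cj_numeral [simp]: "cj (numeral k) = numeral k"
  using cj_of_nat[of "numeral k"] by simp
lemma cj_cj [simp]: "cj (cj x) = x"
  using finite_field_power_card[OF finite_UNIV, of x] card_UNIV
  by (simp add: cj_def power2_eq_square flip: power_mult)
lemma cj_eq_0_iff [simp]: "cj x = 0 \<longleftrightarrow> x = 0" using q_gt_2 by (simp add: cj_def)

lemma of_nat_p [simp]: "of_nat p = (0 :: 'a)" using CHAR of_nat_CHAR by metis

lemma two_eq_0_iff: "(2 :: 'a) = 0 \<longleftrightarrow> p = 2"
proof -
  have "(2 :: 'a) = 0 \<longleftrightarrow> p dvd 2"
    using of_nat_eq_0_iff_char_dvd[of 2, where ?'a = 'a] CHAR by simp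
  then show ?thesis using p by (metis dvd_refl primes_dvd_imp_eq two_is_prime_nat)
qed

text \<open>Otherwise all \<open>q ^ 2 - 1\<close> nonzero elements would be roots of
  \<open>X ^ (q - 1) = 1\<close>.\<close>

lemma exists_not_fixed: "\<exists>x. cj x \<noteq> x"
proof (rule ccontr)
  assume "\<not> (\<exists>x. cj x \<noteq> x)"
  then have fx: "x ^ q = x" for x :: 'a by (auto simp: cj_def)
  have "x ^ (q - 1) = 1" if "x \<noteq> 0" for x :: 'a
    using fx[of x] that q_gt_2 by (cases q) auto
  then have "UNIV - {0 :: 'a} \<subseteq> {x. x ^ (q - 1) = 1}" by auto
  then have "card (UNIV - {0 :: 'a}) \<le> card {x :: 'a. x ^ (q - 1) = 1}"
    by (rule card_mono[rotated]) (rule finite_subset[OF subset_UNIV finite_UNIV])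
  also have "\<dots> \<le> q - 1" using q_gt_2 by (intro card_power_eq_le) simp
  finally have "q ^ 2 \<le> q" using finite_UNIV card_UNIV q_gt_2 by simp
  then show False using q_gt_2 by (simp add: power2_eq_square)
qed

text \<open>This fails for \<open>q = 2\<close>, where every nonzero cube is \<open>1\<close>.\<close>

lemma exists_cube_trace: "\<exists>x. x ^ 3 + cj (x ^ 3) \<noteq> 0"
proof (rule ccontr)
  assume "\<not> (\<exists>x. x ^ 3 + cj (x ^ 3) \<noteq> 0)"
  then have tr: "x ^ 3 + cj x ^ 3 = 0" for x by auto
  \<comment> \<open>The case \<open>x = 1\<close> already forces characteristic 2, where a vanishing
    trace means that every cube is fixed by \<open>cj\<close>. Then the nonzero elements are too
    many roots of \<open>X ^ (3 * (q - 1)) = 1\<close>.\<close>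
  have m1: "(- 1 :: 'a) = 1" using tr[of 1] by (simp add: eq_neg_iff_add_eq_0[symmetric])
  have "x ^ (3 * (q - 1)) = 1" if "x \<noteq> 0" for x :: 'a
  proof -
    have "cj x ^ 3 = x ^ 3" using tr[of x] m1 by (metis add_eq_0_iff mult_minus1 mult_1)
    then have "(x ^ q) ^ 3 = x ^ 3" by (simp add: cj_def)
    moreover have "x ^ q = x ^ (q - 1) * x" using q_gt_2 by (cases q) auto
    ultimately show ?thesis using that
      by (simp add: power_mult_distrib mult.commute flip: power_mult)
  qed
  then have "UNIV - {0 :: 'a} \<subseteq> {x. x ^ (3 * (q - 1)) = 1}" by auto
  then have "card (UNIV - {0 :: 'a}) \<le> card {x :: 'a. x ^ (3 * (q - 1)) = 1}"
    by (rule card_mono[rotated]) (rule finite_subset[OF subset_UNIV finite_UNIV])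
  also have "\<dots> \<le> 3 * (q - 1)" using q_gt_2 by (intro card_power_eq_le) simp
  finally have le: "q ^ 2 - 1 \<le> 3 * (q - 1)" using finite_UNIV card_UNIV by simp
  obtain r where r: "q = r + 3" using q_gt_2 by (metis less_eqE numeral_3_eq_3 Suc_leI add.commute numeral_2_eq_2)
  show False using le by (simp add: r power2_eq_square algebra_simps)
qed

text \<open>The norm \<open>x ^ (q + 1)\<close> has fibres of size at most \<open>q + 1\<close> on
  the \<open>q ^ 2 - 1\<close> nonzero elements, so it takes at least \<open>q - 1\<close> values.
  These exhaust the nonzero fixed elements, the roots of \<open>y ^ (q - 1) = 1\<close>.\<close>

lemma norm_surj:
  assumes y: "cj y = y"
  shows "\<exists>x. x * cj x = y"
proof (cases "y = 0")
  case False
  let ?X = "UNIV - {0 :: 'a}"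
  let ?N = "\<lambda>x :: 'a. x ^ (q + 1)"
  let ?S = "{y :: 'a. y ^ (q - 1) = 1}"
  have N: "?N x = x * cj x" for x by (simp add: cj_def)
  have finX: "finite A" for A :: "'a set" by (rule finite_subset[OF subset_UNIV finite_UNIV])
  have S: "z \<in> ?S \<longleftrightarrow> cj z = z" if "z \<noteq> 0" for z
    using that q_gt_2 unfolding cj_def by (cases q) auto
  have sub: "?N ` ?X \<subseteq> ?S"
  proof
    fix z assume "z \<in> ?N ` ?X"
    then obtain x where "x \<noteq> 0" "z = x * cj x" unfolding N by auto
    then show "z \<in> ?S" using S[of z] by (simp add: mult.commute)
  qed
  have "q ^ 2 - 1 = card ?X" using finite_UNIV card_UNIV by simp
  also have "\<dots> \<le> (\<Sum>z\<in>?N ` ?X. card {x \<in> ?X. ?N x = z})"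
    using sum.image_gen[OF finX[of ?X], of "\<lambda>_. 1 :: nat" ?N] by simp
  also have "\<dots> \<le> (\<Sum>z\<in>?N ` ?X. q + 1)"
  proof (rule sum_mono)
    fix z
    have "card {x \<in> ?X. ?N x = z} \<le> card {x. ?N x = z}" by (rule card_mono[OF finX]) auto
    also have "\<dots> \<le> q + 1" by (rule card_power_eq_le) simp
    finally show "card {x \<in> ?X. ?N x = z} \<le> q + 1" .
  qed
  also have "\<dots> = card (?N ` ?X) * (q + 1)" by simp
  finally have "q ^ 2 - 1 \<le> card (?N ` ?X) * (q + 1)" .
  moreover have "q ^ 2 - 1 = (q - 1) * (q + 1)"
    by (cases q) (auto simp: power2_eq_square)
  ultimately have "(q - 1) * (q + 1) \<le> card (?N ` ?X) * (q + 1)" by (simp only:)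
  then have "q - 1 \<le> card (?N ` ?X)" by (simp only: mult_le_cancel2)
  moreover have "card ?S \<le> q - 1" using q_gt_2 by (intro card_power_eq_le) simp
  ultimately have "?N ` ?X = ?S" using card_seteq[OF finX sub] by simp
  then have "y \<in> ?N ` ?X" using S[OF False] y by blast
  then show ?thesis unfolding N by auto
qed (auto intro: exI[of _ 0])

end

section \<open>The unitary group in hyperbolic coordinates\<close>

text \<open>Naming all nine entries turns matrix identities into polynomial identities in the
  field.\<close>

definition m3 :: "'a \<Rightarrow> 'a \<Rightarrow> 'a \<Rightarrow> 'a \<Rightarrow> 'a \<Rightarrow> 'a \<Rightarrow> 'a \<Rightarrow> 'a \<Rightarrow> 'a \<Rightarrow> 'a mat" where
  "m3 a b c d e f g h i = mat 3 3 (\<lambda>(r, s). [[a, b, c], [d, e, f], [g, h, i]] ! r ! s)"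

lemma m3_carrier [simp]: "m3 a b c d e f g h i \<in> carrier_mat 3 3"
  by (simp add: m3_def)

lemma m3_dim [simp]: "dim_row (m3 a b c d e f g h i) = 3" "dim_col (m3 a b c d e f g h i) = 3"
  by (simp_all add: m3_def)

lemma m3_index [simp]:
  "m3 a b c d e f g h i $$ (0, 0) = a" "m3 a b c d e f g h i $$ (0, Suc 0) = b"
  "m3 a b c d e f g h i $$ (0, 2) = c" "m3 a b c d e f g h i $$ (Suc 0, 0) = d"
  "m3 a b c d e f g h i $$ (Suc 0, Suc 0) = e" "m3 a b c d e f g h i $$ (Suc 0, 2) = f"
  "m3 a b c d e f g h i $$ (2, 0) = g" "m3 a b c d e f g h i $$ (2, Suc 0) = h"
  "m3 a b c d e f g h i $$ (2, 2) = i"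
  by (simp_all add: m3_def)

lemma less_3_cases: "i < 3 \<Longrightarrow> i = 0 \<or> i = Suc 0 \<or> i = (2::nat)" by auto

lemma mat3_eqI:
  assumes "A \<in> carrier_mat 3 3" "B \<in> carrier_mat 3 3"
    and "A $$ (0, 0) = B $$ (0, 0)" "A $$ (0, Suc 0) = B $$ (0, Suc 0)" "A $$ (0, 2) = B $$ (0, 2)"
    "A $$ (Suc 0, 0) = B $$ (Suc 0, 0)" "A $$ (Suc 0, Suc 0) = B $$ (Suc 0, Suc 0)"
    "A $$ (Suc 0, 2) = B $$ (Suc 0, 2)"
    "A $$ (2, 0) = B $$ (2, 0)" "A $$ (2, Suc 0) = B $$ (2, Suc 0)" "A $$ (2, 2) = B $$ (2, 2)"
  shows "A = B"
  by (rule eq_matI) (use assms in \<open>auto dest!: less_3_cases\<close>)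

lemma m3_eta:
  assumes "A \<in> carrier_mat 3 3"
  shows "A = m3 (A $$ (0, 0)) (A $$ (0, Suc 0)) (A $$ (0, 2)) (A $$ (Suc 0, 0)) (A $$ (Suc 0, Suc 0))
    (A $$ (Suc 0, 2)) (A $$ (2, 0)) (A $$ (2, Suc 0)) (A $$ (2, 2))"
  by (rule mat3_eqI) (use assms in auto)

lemma m3_cases:
  assumes "A \<in> carrier_mat 3 3"
  obtains a b c d e f g h i where "A = m3 a b c d e f g h i"
  using m3_eta[OF assms] by blast

lemma m3_eq_iff [simp]:
  "m3 a b c d e f g h i = m3 a' b' c' d' e' f' g' h' i' \<longleftrightarrow>
     a = a' \<and> b = b' \<and> c = c' \<and> d = d' \<and> e = e' \<and> f = f' \<and> g = g' \<and> h = h' \<and> i = i'"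
  (is "?A = ?B \<longleftrightarrow> _")
proof
  assume "?A = ?B"
  then have "?A $$ ij = ?B $$ ij" for ij by simp
  from this[of "(0, 0)"] this[of "(0, Suc 0)"] this[of "(0, 2)"] this[of "(Suc 0, 0)"]
    this[of "(Suc 0, Suc 0)"] this[of "(Suc 0, 2)"] this[of "(2, 0)"] this[of "(2, Suc 0)"]
    this[of "(2, 2)"]
  show "a = a' \<and> b = b' \<and> c = c' \<and> d = d' \<and> e = e' \<and> f = f' \<and> g = g' \<and> h = h' \<and> i = i'"
    by simp
qed simp

lemma sum_upt_3: "(\<Sum>i = 0..<3. f i) = f 0 + f (Suc 0) + f (2::nat)"
  by (simp add: numeral_3_eq_3 numeral_2_eq_2)

lemma m3_mult [simp]:
  fixes a :: "'a::comm_ring_1"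
  shows "m3 a b c d e f g h i * m3 a' b' c' d' e' f' g' h' i' =
    m3 (a * a' + b * d' + c * g') (a * b' + b * e' + c * h') (a * c' + b * f' + c * i')
       (d * a' + e * d' + f * g') (d * b' + e * e' + f * h') (d * c' + e * f' + f * i')
       (g * a' + h * d' + i * g') (g * b' + h * e' + i * h') (g * c' + h * f' + i * i')"
  by (rule mat3_eqI)
     (simp_all add: scalar_prod_def sum_upt_3 mult_carrier_mat[of _ 3 3])

lemma one_mat_3: "1\<^sub>m 3 = m3 1 0 0 0 1 0 0 0 1"
  by (rule mat3_eqI) auto

lemma det_2:
  fixes A :: "'a::comm_ring_1 mat"
  assumes A: "A \<in> carrier_mat 2 2"
  shows "det A = A $$ (0, 0) * A $$ (1, 1) - A $$ (1, 0) * A $$ (0, 1)"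
proof -
  have d: "det (mat_delete A i 0) = mat_delete A i 0 $$ (0, 0)" for i
    by (rule det_single) (use A in \<open>simp add: mat_delete_def\<close>)
  have "det A = (\<Sum>i<2. A $$ (i, 0) * cofactor A i 0)"
    by (rule laplace_expansion_column[OF A]) simp
  then show ?thesis using A d[of 0] d[of 1]
    by (simp add: cofactor_def numeral_2_eq_2) (simp add: mat_delete_def)
qed

lemma det_m3:
  fixes a :: "'a::comm_ring_1"
  shows "det (m3 a b c d e f g h i)
    = a * (e * i - f * h) - b * (d * i - f * g) + c * (d * h - e * g)"
proof -
  let ?A = "m3 a b c d e f g h i"
  have "det (mat_delete ?A r 0) = mat_delete ?A r 0 $$ (0, 0) * mat_delete ?A r 0 $$ (1, 1)
      - mat_delete ?A r 0 $$ (1, 0) * mat_delete ?A r 0 $$ (0, 1)" for r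
    by (rule det_2) (simp add: mat_delete_def)
  moreover have "det ?A = (\<Sum>r = 0..<3. ?A $$ (r, 0) * cofactor ?A r 0)"
    unfolding atLeast0LessThan by (rule laplace_expansion_column[OF m3_carrier]) simp
  ultimately show ?thesis
    by (simp add: sum_upt_3 cofactor_def) (simp add: mat_delete_def numeral_2_eq_2[symmetric] algebra_simps)
qed

lemma conj_transpose_m3:
  "conj_transpose q (m3 a b c d e f g h i)
    = m3 (a ^ q) (d ^ q) (g ^ q) (b ^ q) (e ^ q) (h ^ q) (c ^ q) (f ^ q) (i ^ q)"
  by (rule mat3_eqI) (auto simp: conj_transpose_def)

section \<open>The special unitary group of the antidiagonal form\<close>

context unitary_field begin

text \<open>The adjoint with respect to the Hermitian form \<open>x\<^sub>1 y\<^sub>3\<^sup>q + x\<^sub>2 y\<^sub>2\<^sup>q + x\<^sub>3 y\<^sub>1\<^sup>q\<close>.\<close>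

definition adj :: "'a mat \<Rightarrow> 'a mat" where
  "adj A = mat 3 3 (\<lambda>(i, j). cj (A $$ (2 - j, 2 - i)))"

lemma adj_m3 [simp]:
  "adj (m3 a b c d e f g h i) = m3 (cj i) (cj f) (cj c) (cj h) (cj e) (cj b) (cj g) (cj d) (cj a)"
  by (rule mat3_eqI) (simp_all add: adj_def)

lemma adj_carrier [simp]: "adj A \<in> carrier_mat 3 3" by (simp add: adj_def)

lemma adj_mult:
  "A \<in> carrier_mat 3 3 \<Longrightarrow> B \<in> carrier_mat 3 3 \<Longrightarrow> adj (A * B) = adj B * adj A"
  by (elim m3_cases) (simp add: algebra_simps)

lemma adj_adj [simp]: "A \<in> carrier_mat 3 3 \<Longrightarrow> adj (adj A) = A"
  by (elim m3_cases) simp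

text \<open>In this group \<open>adj\<close> is the inverse; \<open>iso_SU3\<close> identifies it
  with \<open>SU3 q\<close>.\<close>

definition SUJ :: "'a mat monoid" where
  "SUJ = \<lparr>carrier = {A \<in> carrier_mat 3 3. A * adj A = 1\<^sub>m 3 \<and> det A = 1}, monoid.mult = (*), one = 1\<^sub>m 3\<rparr>"

lemma SUJ_carrier: "A \<in> carrier SUJ \<longleftrightarrow> A \<in> carrier_mat 3 3 \<and> A * adj A = 1\<^sub>m 3 \<and> det A = 1"
  by (simp add: SUJ_def)

lemma SUJ_simps [simp]: "x \<otimes>\<^bsub>SUJ\<^esub> y = x * y" "\<one>\<^bsub>SUJ\<^esub> = 1\<^sub>m 3"
  by (simp_all add: SUJ_def)

lemma SUJ_D:
  assumes "A \<in> carrier SUJ"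
  shows "A \<in> carrier_mat 3 3" "A * adj A = 1\<^sub>m 3" "adj A * A = 1\<^sub>m 3" "det A = 1"
  using assms mat_mult_left_right_inverse[of A 3 "adj A"] by (auto simp: SUJ_carrier)

lemma SUJ_mult:
  assumes A: "A \<in> carrier SUJ" and B: "B \<in> carrier SUJ"
  shows "A * B \<in> carrier SUJ"
proof -
  note [simp] = SUJ_D[OF A] SUJ_D[OF B]
  note as = assoc_mult_mat[of _ 3 3 _ 3 _ 3] mult_carrier_mat[of _ 3 3 _ 3]
  have "B * (adj B * adj A) = adj A"
    by (subst as(1)[symmetric]) (simp_all add: left_mult_one_mat[OF adj_carrier])
  then have "(A * B) * adj (A * B) = 1\<^sub>m 3"
    by (simp add: adj_mult as)
  then show ?thesis by (simp add: SUJ_carrier det_mult[of _ 3] mult_carrier_mat[of _ 3 3])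
qed

lemma SUJ_adj:
  assumes A: "A \<in> carrier SUJ"
  shows "adj A \<in> carrier SUJ"
proof -
  have "det (A * adj A) = det A * det (adj A)" by (rule det_mult) (use SUJ_D[OF A] in auto)
  then show ?thesis using SUJ_D[OF A] by (simp add: SUJ_carrier)
qed

lemma SUJ_cancel:
  assumes A: "A \<in> carrier SUJ" and B: "B \<in> carrier_mat 3 3"
  shows "A * (adj A * B) = B" "adj A * (A * B) = B"
  using SUJ_D[OF A] B by (simp_all add: assoc_mult_mat[of _ 3 3 _ 3 _ 3, symmetric])

lemma group_SUJ: "group SUJ"
proof (rule groupI)
  show "\<one>\<^bsub>SUJ\<^esub> \<in> carrier SUJ" by (simp add: SUJ_carrier one_mat_3 det_m3)
  fix x y z assume "x \<in> carrier SUJ" "y \<in> carrier SUJ" "z \<in> carrier SUJ"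
  then show "x \<otimes>\<^bsub>SUJ\<^esub> y \<otimes>\<^bsub>SUJ\<^esub> z = x \<otimes>\<^bsub>SUJ\<^esub> (y \<otimes>\<^bsub>SUJ\<^esub> z)"
    by (auto simp: SUJ_carrier intro: assoc_mult_mat)
  show "\<one>\<^bsub>SUJ\<^esub> \<otimes>\<^bsub>SUJ\<^esub> x = x" using SUJ_D[OF \<open>x \<in> carrier SUJ\<close>] by simp
  show "\<exists>y\<in>carrier SUJ. y \<otimes>\<^bsub>SUJ\<^esub> x = \<one>\<^bsub>SUJ\<^esub>"
    using SUJ_D[OF \<open>x \<in> carrier SUJ\<close>] SUJ_adj[OF \<open>x \<in> carrier SUJ\<close>] by auto
qed (auto simp: SUJ_mult)

sublocale G: group SUJ by (rule group_SUJ)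

lemma SUJ_inv: "A \<in> carrier SUJ \<Longrightarrow> inv\<^bsub>SUJ\<^esub> A = adj A"
  by (rule G.inv_equality) (auto simp: SUJ_D SUJ_adj)

lemma finite_SUJ: "finite (carrier SUJ)"
proof -
  let ?f = "\<lambda>(a, b, c, d, e, f, g, h, i). m3 a b c d e f g h i :: 'a mat"
  have "carrier SUJ \<subseteq> range ?f"
    by (auto simp: SUJ_carrier image_iff elim!: m3_cases)
  moreover have "finite (UNIV :: ('a \<times> 'a \<times> 'a \<times> 'a \<times> 'a \<times> 'a \<times> 'a \<times> 'a \<times> 'a) set)"
    using finite_UNIV by (simp add: finite_prod)
  ultimately show ?thesis by (meson finite_imageI finite_subset)
qed

section \<open>Unitriangular elements and the Bruhat decomposition\<close>

definition upp :: "'a \<Rightarrow> 'a \<Rightarrow> 'a mat" where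
  "upp \<alpha> \<beta> = m3 1 (- cj \<alpha>) \<beta> 0 1 \<alpha> 0 0 1"

definition low :: "'a \<Rightarrow> 'a \<Rightarrow> 'a mat" where
  "low \<gamma> \<delta> = m3 1 0 0 \<gamma> 1 0 \<delta> (- cj \<gamma>) 1"

text \<open>Monomial elements exchanging the two singular coordinate lines, one for each nonzero
  scalar; the middle entry is the one that makes the determinant 1.\<close>

definition weyl :: "'a \<Rightarrow> 'a mat" where
  "weyl x = m3 0 0 x 0 (- cj x / x) 0 (1 / cj x) 0 0"

lemma upp_SUJ_iff: "upp \<alpha> \<beta> \<in> carrier SUJ \<longleftrightarrow> \<beta> + cj \<beta> = - (\<alpha> * cj \<alpha>)"
  by (simp add: SUJ_carrier upp_def one_mat_3 det_m3)
     (simp add: eq_neg_iff_add_eq_0 ac_simps)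

lemma weyl_SUJ: "x \<noteq> 0 \<Longrightarrow> weyl x \<in> carrier SUJ"
  by (simp add: SUJ_carrier weyl_def one_mat_3 det_m3 field_simps)

lemma upp_mult: "upp \<alpha> \<beta> * upp \<alpha>' \<beta>' = upp (\<alpha> + \<alpha>') (\<beta> + \<beta>' - cj \<alpha> * \<alpha>')"
  by (simp add: upp_def algebra_simps)

lemma upp_eq_iff [simp]: "upp \<alpha> \<beta> = upp \<alpha>' \<beta>' \<longleftrightarrow> \<alpha> = \<alpha>' \<and> \<beta> = \<beta>'"
  by (auto simp: upp_def)

lemma one_eq_upp: "1\<^sub>m 3 = upp 0 0" by (simp add: upp_def one_mat_3)

lemma adj_upp: "adj (upp \<alpha> \<beta>) = upp (- \<alpha>) (cj \<beta>)"
  by (simp add: upp_def)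

lemma weyl_upp_weyl:
  assumes "y \<noteq> 0"
  shows "weyl y * upp \<alpha> \<beta> * adj (weyl y) = low (- \<alpha> * cj y / y\<^sup>2) (\<beta> / (y * cj y))"
  using assms by (simp add: weyl_def upp_def low_def field_simps power2_eq_square)

text \<open>The first column is singular, so \<open>cj d * d = 0\<close>; the other entries of
  \<open>adj A * A = 1\<close> and the determinant then fix the shape.\<close>

lemma upper_SUJ:
  assumes A: "m3 1 b c d e f 0 h i \<in> carrier SUJ"
  obtains \<alpha> \<beta> where "m3 1 b c d e f 0 h i = upp \<alpha> \<beta>"
proof -
  note D = SUJ_D[OF A, simplified one_mat_3 adj_m3 m3_mult m3_eq_iff det_m3]
  have "d = 0" "i = 1" "h = 0" using D by auto
  moreover from this have "e = 1" "b = - cj f" using D by (auto simp: add_eq_0_iff2)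
  ultimately show ?thesis using that[of f c] by (simp add: upp_def)
qed

text \<open>The first column of \<open>A\<close> determines the left unitriangular factor and the
  Weyl element. Removing both leaves a first column with top entry 1 and bottom entry 0, hence a
  unitriangular matrix by \<open>upper_SUJ\<close>.\<close>

lemma Bruhat:
  assumes A: "A \<in> carrier SUJ" and z: "A $$ (2, 0) = z" "z \<noteq> 0"
  obtains \<alpha> \<beta> \<alpha>' \<beta>' where "upp \<alpha> \<beta> \<in> carrier SUJ" "upp \<alpha>' \<beta>' \<in> carrier SUJ"
    "A = upp \<alpha> \<beta> * (weyl (1 / cj z) * upp \<alpha>' \<beta>')"
proof -
  obtain a b c d e f h i where Am: "A = m3 a b c d e f z h i"
    using m3_cases[OF SUJ_D(1)[OF A]] z(1) by (metis m3_index(7))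
  have zero: "cj z * a + cj d * d + cj a * z = 0"
    using SUJ_D(3)[OF A] by (simp add: Am one_mat_3)
  then have "a / z + cj (a / z) = - (d / z * cj (d / z))"
    using z(2) by (simp add: divide_simps) (simp add: eq_neg_iff_add_eq_0 ac_simps)
  then have U: "upp (d / z) (a / z) \<in> carrier SUJ" by (simp add: upp_SUJ_iff)
  have W: "weyl (1 / cj z) \<in> carrier SUJ" using z(2) by (intro weyl_SUJ) simp
  define B where "B = adj (weyl (1 / cj z)) * (adj (upp (d / z) (a / z)) * A)"
  have B: "B \<in> carrier SUJ"
    using U W A by (simp add: B_def SUJ_mult SUJ_adj)
  have "B $$ (0, 0) = 1" "B $$ (2, 0) = 0"
    using z(2) zero by (simp_all add: B_def upp_def weyl_def Am divide_simps)
      (simp add: algebra_simps)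
  then have "\<exists>b c d e f h i. B = m3 1 b c d e f 0 h i"
    using m3_eta[OF SUJ_D(1)[OF B]] by metis
  then obtain \<alpha>' \<beta>' where Bu: "B = upp \<alpha>' \<beta>'" using upper_SUJ B by metis
  have "upp (d / z) (a / z) * (weyl (1 / cj z) * B) = A"
    using U W SUJ_D(1)[OF A]
    by (simp add: B_def SUJ_cancel SUJ_D mult_carrier_mat[of _ 3 3 _ 3])
  then show ?thesis using that U B Bu by metis
qed

text \<open>Stripping unitriangular factors from \<open>A\<close> leaves one Weyl element in
  \<open>M\<close>, products with unitriangular elements yield all the others, and
  \<open>Bruhat\<close> then covers the big cell. The remaining elements are moved into the big cell
  by \<open>weyl 1\<close>.\<close>

lemma subgroup_full:
  assumes M: "subgroup M SUJ" and U: "\<And>\<alpha> \<beta>. upp \<alpha> \<beta> \<in> carrier SUJ \<Longrightarrow> upp \<alpha> \<beta> \<in> M"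
    and A: "A \<in> M" "A $$ (2, 0) \<noteq> 0"
  shows "M = carrier SUJ"
proof -
  have sub: "M \<subseteq> carrier SUJ" using M by (simp add: subgroup.subset)
  have Mm: "X * Y \<in> M" if "X \<in> M" "Y \<in> M" for X Y
    using subgroup.m_closed[OF M that] by simp
  have Mi: "adj X \<in> M" if "X \<in> M" for X
    using subgroup.m_inv_closed[OF M that] SUJ_inv[of X] that sub by auto
  note as = assoc_mult_mat[of _ 3 3 _ 3 _ 3] mult_carrier_mat[of _ 3 3 _ 3]
  have weyl_M: "weyl (1 / cj (X $$ (2, 0))) \<in> M" if X: "X \<in> M" "X $$ (2, 0) \<noteq> 0" for X
  proof -
    have Xc: "X \<in> carrier SUJ" using X sub by auto
    from Bruhat[OF Xc refl X(2)] obtain \<alpha> \<beta> \<alpha>' \<beta>'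
      where *: "upp \<alpha> \<beta> \<in> carrier SUJ" "upp \<alpha>' \<beta>' \<in> carrier SUJ"
        "X = upp \<alpha> \<beta> * (weyl (1 / cj (X $$ (2, 0))) * upp \<alpha>' \<beta>')" by metis
    let ?w = "weyl (1 / cj (X $$ (2, 0)))"
    have w: "?w \<in> carrier SUJ" using X(2) by (intro weyl_SUJ) simp
    have "adj (upp \<alpha> \<beta>) * X = ?w * upp \<alpha>' \<beta>'"
      using *(1) by (subst *(3)) (intro SUJ_cancel, auto simp: w *(2) SUJ_mult SUJ_D)
    then have "adj (upp \<alpha> \<beta>) * X * adj (upp \<alpha>' \<beta>') = ?w"
      using w *(2) by (simp add: as SUJ_D right_mult_one_mat[OF SUJ_D(1)[OF w]])
    moreover have "adj (upp \<alpha> \<beta>) * X * adj (upp \<alpha>' \<beta>') \<in> M"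
      using * U X by (intro Mm Mi) auto
    ultimately show ?thesis by metis
  qed
  define x where "x = 1 / cj (A $$ (2, 0))"
  have x: "weyl x \<in> M" "x \<noteq> 0" using weyl_M[OF A] A by (auto simp: x_def)
  have weyl_all: "weyl y \<in> M" if y: "y \<noteq> 0" for y
  proof -
    \<comment> \<open>Chosen so that \<open>weyl x * upp \<alpha> \<beta> * weyl x\<close> has
      corner entry \<open>1 / cj y\<close>, whose associated Weyl element is
      \<open>weyl y\<close>.\<close>
    define \<beta> where "\<beta> = (cj x)\<^sup>2 / cj y"
    have "cj (- (\<beta> + cj \<beta>)) = - (\<beta> + cj \<beta>)" by simp
    then obtain \<alpha> where "\<alpha> * cj \<alpha> = - (\<beta> + cj \<beta>)" using norm_surj by blast
    then have "upp \<alpha> \<beta> \<in> M" by (intro U) (simp add: upp_SUJ_iff)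
    then have "weyl x * upp \<alpha> \<beta> * weyl x \<in> M" using x Mm by blast
    moreover have "(weyl x * upp \<alpha> \<beta> * weyl x) $$ (2, 0) = 1 / cj y"
      using x(2) y by (simp add: weyl_def upp_def \<beta>_def power2_eq_square)
    ultimately show ?thesis using weyl_M[of "weyl x * upp \<alpha> \<beta> * weyl x"] y by simp
  qed
  have big: "X \<in> M" if X: "X \<in> carrier SUJ" "X $$ (2, 0) \<noteq> 0" for X
  proof -
    from Bruhat[OF X(1) refl X(2)] obtain \<alpha> \<beta> \<alpha>' \<beta>'
      where *: "upp \<alpha> \<beta> \<in> carrier SUJ" "upp \<alpha>' \<beta>' \<in> carrier SUJ"
        "X = upp \<alpha> \<beta> * (weyl (1 / cj (X $$ (2, 0))) * upp \<alpha>' \<beta>')" by metis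
    have "weyl (1 / cj (X $$ (2, 0))) \<in> M" using X by (intro weyl_all) simp
    then show ?thesis using * U Mm by metis
  qed
  have "X \<in> M" if X: "X \<in> carrier SUJ" for X
  proof (cases "X $$ (2, 0) = 0")
    case True
    obtain a b c d e f h i where Xm: "X = m3 a b c d e f 0 h i"
      using m3_cases[OF SUJ_D(1)[OF X]] True by (metis m3_index(7))
    have "a \<noteq> 0" "cj d * d = 0" using SUJ_D[OF X] by (auto simp: Xm one_mat_3)
    have W: "weyl 1 \<in> M" by (rule weyl_all) simp
    then have Wc: "weyl 1 \<in> carrier SUJ" using sub by auto
    moreover have "(weyl 1 * X) $$ (2, 0) \<noteq> 0" using \<open>a \<noteq> 0\<close> by (simp add: Xm weyl_def)
    ultimately have "weyl 1 * X \<in> M" by (intro big SUJ_mult X)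
    then have "adj (weyl 1) * (weyl 1 * X) \<in> M" using W Mi Mm by blast
    moreover have "adj (weyl 1) * (weyl 1 * X) = X"
      using SUJ_D[OF Wc] SUJ_D[OF X] by (subst as(1)[symmetric]) simp_all
    ultimately show ?thesis by simp
  qed (use big X in auto)
  then show ?thesis using sub by auto
qed


section \<open>Edges of the Killing graph that move the fixed singular line\<close>

lemma conj_by_SUJ: "h \<in> carrier SUJ \<Longrightarrow> G.conj_by h x = h * x * adj h"
  by (simp add: G.conj_by_def SUJ_inv)

lemma conj_by_upp_upp:
  assumes "upp \<xi> \<eta> \<in> carrier SUJ"
  shows "G.conj_by (upp \<xi> \<eta>) (upp \<kappa> \<beta>) = upp \<kappa> (\<beta> + cj \<kappa> * \<xi> - cj \<xi> * \<kappa>)"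
proof -
  have "\<eta> + cj \<eta> = - (\<xi> * cj \<xi>)" using assms by (simp add: upp_SUJ_iff)
  then have "cj \<eta> = - (\<xi> * cj \<xi>) - \<eta>" by (metis add_diff_cancel_left')
  then show ?thesis
    using assms by (simp add: conj_by_SUJ adj_upp upp_mult algebra_simps)
qed

lemma conj_by_weyl_upp:
  "y \<noteq> 0 \<Longrightarrow> G.conj_by (weyl y) (upp \<alpha> \<beta>) = low (- \<alpha> * cj y / y\<^sup>2) (\<beta> / (y * cj y))"
  using weyl_upp_weyl by (simp add: conj_by_SUJ weyl_SUJ)

text \<open>Finding a neighbour witness reduces to writing the product of two class members as a
  conjugate of some \<open>z\<close> that commutes with \<open>x\<close>.\<close>

lemma conj_by_comm:
  assumes "k \<in> carrier SUJ" "x \<in> carrier SUJ" "z \<in> carrier SUJ" "x * z = z * x" "y = G.conj_by k z"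
  shows "G.conj_by k x * y = y * G.conj_by k x"
  using assms G.conj_by_mult[of k x z] G.conj_by_mult[of k z x] by simp

text \<open>The product of an upper and a lower unipotent element, written in the basis adapted to its
  fixed singular vector \<open>(-h, -c/k, 1)\<close>.\<close>

lemma regular_product:
  fixes \<kappa> k b c h g :: 'a
  assumes nz: "\<kappa> \<noteq> 0" "k \<noteq> 0" "h \<noteq> 0" "g \<noteq> 0"
    and tr: "b + c = - (\<kappa> * k)" and hg: "(h + g) * (\<kappa> * k) = b * c"
  shows "m3 1 (- k) b 0 1 \<kappa> 0 0 1 * m3 1 0 0 (\<kappa> / h) 1 0 (c / (h * g)) (- (k / g)) 1
      * m3 1 (b / \<kappa>) (- h) 0 1 (- (c / k)) 0 0 1
    = m3 1 (b / \<kappa>) (- h) 0 1 (- (c / k)) 0 0 1 * m3 1 0 0 (- (\<kappa> / g)) 1 0 (c / (h * g)) (k / h) 1"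
proof -
  \<comment> \<open>Eliminating \<open>c\<close> by \<open>tr\<close> and \<open>b * b\<close> by
    \<open>hg\<close> decides every entry; \<open>b3\<close> is \<open>b2\<close> in the
    right-nested form that \<open>algebra_simps\<close> produces.\<close>
  have c: "c = - (\<kappa> * k) - b" using tr by (metis add_diff_cancel_left')
  have b2: "b * b = - (\<kappa> * k) * (h + g + b)" using hg by (simp add: c algebra_simps)
  have b3: "b * (b * x) = - (\<kappa> * k) * (h + g + b) * x" for x using b2 by (metis mult.assoc)
  show ?thesis
    by (simp add: nz, intro conjI; simp add: nz divide_simps; simp add: c algebra_simps b2 b3)
qed

text \<open>For \<open>A = weyl y * upp \<xi> \<eta>\<close> the conjugate of \<open>upp \<kappa> \<beta>\<close> by \<open>A\<close> is \<open>low (\<kappa> / h) (\<beta>\<^sup>q / h\<^bsup>q+1\<^esup>)\<close>, and its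
  product with \<open>upp \<kappa> \<beta>\<close> has trace \<open>3\<close> iff \<open>(h + h\<^sup>q) \<kappa>\<^bsup>q+1\<^esup> = \<beta>\<^bsup>q+1\<^esup>\<close>. Taking \<open>h = s x\<^sup>3\<close> with \<open>s\<^sup>q = s\<close> makes
  the first unitriangular parameters of all three elements proportional over the fixed field.\<close>

lemma regular_edge:
  assumes c0: "upp \<kappa> \<beta> \<in> carrier SUJ" and k: "\<kappa> \<noteq> 0"
  obtains A B where "A \<in> carrier SUJ" "B \<in> carrier SUJ" "A $$ (2, 0) \<noteq> 0"
    "G.conj_by B (upp \<kappa> \<beta>) * (upp \<kappa> \<beta> * G.conj_by A (upp \<kappa> \<beta>))
      = upp \<kappa> \<beta> * G.conj_by A (upp \<kappa> \<beta>) * G.conj_by B (upp \<kappa> \<beta>)"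
proof -
  have tr: "\<beta> + cj \<beta> = - (\<kappa> * cj \<kappa>)" using c0 by (simp add: upp_SUJ_iff)
  have b: "\<beta> \<noteq> 0" using tr k by auto
  obtain x where x: "x ^ 3 + cj (x ^ 3) \<noteq> 0" using exists_cube_trace by blast
  then have x0: "x \<noteq> 0" by auto
  define \<tau> where "\<tau> = x ^ 3 + cj x ^ 3"
  have \<tau>: "\<tau> \<noteq> 0" "cj \<tau> = \<tau>" using x by (simp_all add: \<tau>_def add.commute)
  \<comment> \<open>Scaled so that \<open>hh\<close> holds; \<open>s\<close> is fixed by
    \<open>cj\<close> because \<tau> is.\<close>
  define s where "s = \<beta> * cj \<beta> / (\<kappa> * cj \<kappa> * \<tau>)"
  have s: "s \<noteq> 0" "cj s = s" using b k \<tau> by (simp_all add: s_def mult.commute)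
  define h where "h = s * x ^ 3"
  \<comment> \<open>Solves \<open>- \<kappa> * cj y / y\<^sup>2 = \<kappa> / h\<close> and
    \<open>y * cj y = h * cj h\<close>, as needed for conjugation by \<open>weyl y\<close>.\<close>
  define y where "y = - s * (x * cj x) * x"
  have h: "h \<noteq> 0" "cj h = s * cj x ^ 3" using s x0 by (simp_all add: h_def)
  have y: "y \<noteq> 0" "cj y = - s * (x * cj x) * cj x"
    using s x0 by (simp_all add: y_def mult.commute)
  have hh: "(h + cj h) * (\<kappa> * cj \<kappa>) = \<beta> * cj \<beta>"
  proof -
    have "h + cj h = s * \<tau>" by (simp add: h) (simp add: h_def \<tau>_def algebra_simps)
    then show ?thesis using \<tau> k by (simp add: s_def)
  qed
  \<comment> \<open>Conjugation by \<open>upp \<xi> \<eta>\<close> replaces \<beta> by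
    \<open>cj \<beta>\<close>; \<eta> is a multiple of \<beta> by a scalar fixed by
    \<open>cj\<close>, so that \<open>tr\<close> yields the unitarity condition.\<close>
  define \<xi> where "\<xi> = - \<beta> / cj \<kappa>"
  define \<eta> where "\<eta> = \<xi> * cj \<xi> / (\<kappa> * cj \<kappa>) * \<beta>"
  have "\<eta> + cj \<eta> = \<xi> * cj \<xi> / (\<kappa> * cj \<kappa>) * (\<beta> + cj \<beta>)"
    by (simp add: \<eta>_def algebra_simps add_divide_distrib)
  also have "\<dots> = - (\<xi> * cj \<xi>)" using k by (simp add: tr)
  finally have U: "upp \<xi> \<eta> \<in> carrier SUJ" by (simp add: upp_SUJ_iff)
  have conj1: "G.conj_by (upp \<xi> \<eta>) (upp \<kappa> \<beta>) = upp \<kappa> (cj \<beta>)"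
    unfolding conj_by_upp_upp[OF U] using k by (simp add: \<xi>_def)
  define A where "A = weyl y * upp \<xi> \<eta>"
  have A: "A \<in> carrier SUJ" using U y by (simp add: A_def SUJ_mult weyl_SUJ)
  have A20: "A $$ (2, 0) \<noteq> 0" using y(1) by (simp add: A_def weyl_def upp_def)
  have "G.conj_by A (upp \<kappa> \<beta>) = G.conj_by (weyl y) (upp \<kappa> (cj \<beta>))"
    using G.conj_by_conj_by[of "weyl y" "upp \<xi> \<eta>" "upp \<kappa> \<beta>"] U c0 y by (simp add: A_def weyl_SUJ conj1)
  also have "\<dots> = low (- \<kappa> * cj y / y\<^sup>2) (cj \<beta> / (y * cj y))" using y by (simp add: conj_by_weyl_upp)
  also have "- \<kappa> * cj y / y\<^sup>2 = \<kappa> / h"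
    using s x0 by (simp add: y) (simp add: y_def h_def field_simps power2_eq_square power3_eq_cube)
  also have "y * cj y = h * cj h"
    by (simp add: y h) (simp add: y_def h_def power3_eq_cube)
  finally have conjA: "G.conj_by A (upp \<kappa> \<beta>) = low (\<kappa> / h) (cj \<beta> / (h * cj h))" .
  \<comment> \<open>The third column of \<open>W\<close> is the fixed singular vector of the
    product, and the unitarity of \<open>W\<close> amounts to \<open>hh\<close>.\<close>
  define W where "W = upp (- cj \<beta> / cj \<kappa>) (- h)"
  have W: "W \<in> carrier SUJ"
    using hh k by (simp add: W_def upp_SUJ_iff field_simps)
  \<comment> \<open>The upper counterpart of the lower factor on the right of
    \<open>regular_product\<close>. Since \<open>s * (x * cj x)\<close> is fixed by
    \<open>cj\<close>, it commutes with \<open>upp \<kappa> \<beta>\<close>.\<close>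
  define z where "z = upp (\<kappa> / (s * (x * cj x))) (cj \<beta> * (x * cj x) / (h * cj h))"
  have cz: "G.conj_by (weyl (cj x)) z = low (- (\<kappa> / cj h)) (cj \<beta> / (h * cj h))"
    unfolding z_def using x0 s by (simp add: conj_by_weyl_upp) (simp add: h low_def field_simps power2_eq_square power3_eq_cube)
  have "upp \<kappa> \<beta> * low (\<kappa> / h) (cj \<beta> / (h * cj h)) * W = W * low (- (\<kappa> / cj h)) (cj \<beta> / (h * cj h))"
  proof -
    have m: "W = m3 1 (\<beta> / \<kappa>) (- h) 0 1 (- (cj \<beta> / cj \<kappa>)) 0 0 1"
      "upp \<kappa> \<beta> = m3 1 (- cj \<kappa>) \<beta> 0 1 \<kappa> 0 0 1"
      "low (\<kappa> / h) \<delta> = m3 1 0 0 (\<kappa> / h) 1 0 \<delta> (- (cj \<kappa> / cj h)) 1"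
      "low (- (\<kappa> / cj h)) \<delta> = m3 1 0 0 (- (\<kappa> / cj h)) 1 0 \<delta> (cj \<kappa> / h) 1" for \<delta>
      by (simp_all add: W_def upp_def low_def)
    show ?thesis unfolding m using k h(1) tr hh by (intro regular_product) simp_all
  qed
  then have XW: "upp \<kappa> \<beta> * low (\<kappa> / h) (cj \<beta> / (h * cj h)) = G.conj_by W (G.conj_by (weyl (cj x)) z)"
    (is "?X = _")
  proof -
    have "?X * W * adj W = G.conj_by W (G.conj_by (weyl (cj x)) z)"
      using W \<open>?X * W = _\<close> by (simp add: cz conj_by_SUJ)
    moreover have "?X * W * adj W = ?X"
      using SUJ_D[OF W] by (subst assoc_mult_mat[of _ 3 3 _ 3 _ 3]) (simp_all add: upp_def low_def)
    ultimately show ?thesis by simp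
  qed
  have z: "z \<in> carrier SUJ"
  proof -
    have "cj \<beta> = - (\<kappa> * cj \<kappa>) - \<beta>" using tr by (metis add_diff_cancel_left')
    then show ?thesis unfolding z_def using k s x0
      by (simp add: upp_SUJ_iff h h_def divide_simps) (simp add: power3_eq_cube algebra_simps)
  qed
  define B where "B = W * weyl (cj x)"
  have B: "B \<in> carrier SUJ" using W x0 by (simp add: B_def SUJ_mult weyl_SUJ)
  have "upp \<kappa> \<beta> * G.conj_by A (upp \<kappa> \<beta>) = G.conj_by B z"
    using G.conj_by_conj_by[of W "weyl (cj x)" z] W x0 z by (simp add: B_def weyl_SUJ XW conjA)
  moreover have "upp \<kappa> \<beta> * z = z * upp \<kappa> \<beta>"
    using s by (simp add: z_def upp_mult algebra_simps)
  ultimately show ?thesis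
    using that[OF A B A20] conj_by_comm[OF B c0 z] by metis
qed

text \<open>On the hyperbolic plane the product of \<open>upp 0 \<mu>\<close> and
  \<open>low 0 (- 4 / \<mu>)\<close> has determinant 1 and trace -2, so it is conjugate to an upper
  triangular \<open>z\<close> with double eigenvalue -1, which commutes with
  \<open>upp 0 \<mu>\<close>.\<close>

lemma transvection_edge:
  assumes c0: "upp 0 \<mu> \<in> carrier SUJ" and l: "\<mu> \<noteq> 0" and p2: "p \<noteq> 2"
  obtains A B where "A \<in> carrier SUJ" "B \<in> carrier SUJ" "A $$ (2, 0) \<noteq> 0"
    "G.conj_by B (upp 0 \<mu>) * (upp 0 \<mu> * G.conj_by A (upp 0 \<mu>))
      = upp 0 \<mu> * G.conj_by A (upp 0 \<mu>) * G.conj_by B (upp 0 \<mu>)"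
proof -
  have tr: "cj \<mu> = - \<mu>" using c0 by (simp add: upp_SUJ_iff add_eq_0_iff)
  have two: "(2 :: 'a) \<noteq> 0" using p2 two_eq_0_iff by simp
  have "(4 :: 'a) = 2 * 2" "(8 :: 'a) = 2 * 2 * 2" by simp_all
  then have four: "(4 :: 'a) \<noteq> 0" "(8 :: 'a) \<noteq> 0" using two by (metis mult_eq_0_iff)+
  define A where "A = weyl (\<mu> / 2)"
  have A: "A \<in> carrier SUJ" "A $$ (2, 0) \<noteq> 0"
    using l two by (auto simp: A_def weyl_SUJ) (simp add: weyl_def)
  have conjA: "G.conj_by A (upp 0 \<mu>) = low 0 (- 4 / \<mu>)"
    using l two by (simp add: A_def conj_by_weyl_upp tr field_simps)
  \<comment> \<open>The third column of \<open>W\<close> is the eigenvector of the product for the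
    eigenvalue -1.\<close>
  define W where "W = upp 0 (\<mu> / 2)"
  have W: "W \<in> carrier SUJ" using two by (simp add: W_def upp_SUJ_iff tr)
  define z where "z = m3 (- 1) 0 (- 4 / \<mu>) 0 1 0 0 0 (- 1)"
  have z: "z \<in> carrier SUJ" using l by (simp add: z_def SUJ_carrier one_mat_3 det_m3 tr)
  define B where "B = W * weyl 1"
  have w1: "weyl 1 \<in> carrier SUJ" by (simp add: weyl_SUJ)
  have B: "B \<in> carrier SUJ" using W w1 by (simp add: B_def SUJ_mult)
  have "upp 0 \<mu> * low 0 (- 4 / \<mu>) = B * z * adj B"
    using l two four by (simp add: B_def W_def weyl_def upp_def low_def z_def tr field_simps)
  then have "upp 0 \<mu> * G.conj_by A (upp 0 \<mu>) = G.conj_by B z"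
    using B by (simp add: conjA conj_by_SUJ)
  moreover have "upp 0 \<mu> * z = z * upp 0 \<mu>" by (simp add: z_def upp_def)
  ultimately show ?thesis
    using that[OF A(1) B A(2)] conj_by_comm[OF B c0 z] by metis
qed

end

section \<open>Unipotent elements\<close>

definition sc :: "'a::field \<Rightarrow> 'a \<times> 'a \<times> 'a \<Rightarrow> 'a \<times> 'a \<times> 'a" where
  "sc c v = (c * fst v, c * fst (snd v), c * snd (snd v))"

lemma sc_simps [simp]: "sc 0 v = 0" "sc 1 v = v" "sc c 0 = 0"
  by (auto simp: sc_def zero_prod_def)

lemma sc_add: "sc (c + d) v = sc c v + sc d v" "sc c (u + v) = sc c u + sc c v"
  by (auto simp: sc_def prod_eq_iff algebra_simps)

definition lin :: "('a::field \<times> 'a \<times> 'a \<Rightarrow> 'a \<times> 'a \<times> 'a) \<Rightarrow> bool" where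
  "lin f \<longleftrightarrow> (\<forall>u v. f (u + v) = f u + f v) \<and> (\<forall>c v. f (sc c v) = sc c (f v))"

lemma linD: "lin f \<Longrightarrow> f (u + v) = f u + f v" "lin f \<Longrightarrow> f (sc c v) = sc c (f v)"
  unfolding lin_def by blast+

lemma lin_zero: "lin f \<Longrightarrow> f 0 = 0"
  unfolding lin_def by (metis sc_simps(1))

lemma lin_sum: "lin f \<Longrightarrow> f (sum g A) = (\<Sum>x\<in>A. f (g x))"
  by (induction A rule: infinite_finite_induct) (auto simp: lin_zero linD(1))

lemma lin_funpow: "lin f \<Longrightarrow> lin (f ^^ n)"
proof (induction n)
  case (Suc n)
  show ?case using linD[OF Suc.IH[OF Suc.prems]] linD[OF Suc.prems] by (simp add: lin_def)
qed (simp add: lin_def)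

text \<open>The binomial theorem for \<open>f = 1 + D\<close>, proved by Pascal's rule.\<close>

lemma lin_funpow_binomial:
  assumes f: "lin f" and D: "\<And>v. f v = v + D v"
  shows "(f ^^ n) v = (\<Sum>k\<le>n. sc (of_nat (n choose k)) ((D ^^ k) v))"
proof (induction n)
  case (Suc n)
  let ?a = "\<lambda>n k. sc (of_nat (n choose k)) ((D ^^ k) v)"
  let ?b = "\<lambda>k. sc (of_nat (n choose k)) ((D ^^ Suc k) v)"
  have "(f ^^ Suc n) v = (\<Sum>k\<le>n. f (?a n k))"
    by (simp add: Suc lin_sum[OF f])
  also have "\<dots> = (\<Sum>k\<le>n. ?a n k + ?b k)"
  proof (rule sum.cong)
    fix k
    have "f (?a n k) = sc (of_nat (n choose k)) (f ((D ^^ k) v))" using linD(2)[OF f] by blast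
    then show "f (?a n k) = ?a n k + ?b k" by (simp add: D sc_add)
  qed simp
  also have "\<dots> = (\<Sum>k\<le>n. ?a n k) + (\<Sum>k\<le>n. ?b k)" by (rule sum.distrib)
  also have "(\<Sum>k\<le>n. ?a n k) = (\<Sum>k\<le>Suc n. ?a n k)" by (simp add: binomial_eq_0)
  also have "\<dots> = ?a n 0 + (\<Sum>k\<le>n. ?a n (Suc k))" by (rule sum.atMost_Suc_shift)
  also have "\<dots> + (\<Sum>k\<le>n. ?b k) = ?a n 0 + (\<Sum>k\<le>n. ?a n (Suc k) + ?b k)"
    by (simp add: sum.distrib add.assoc)
  also have "(\<Sum>k\<le>n. ?a n (Suc k) + ?b k) = (\<Sum>k\<le>n. ?a (Suc n) (Suc k))"
    by (rule sum.cong) (auto simp: sc_add add.commute)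
  also have "?a n 0 + \<dots> = (\<Sum>k\<le>Suc n. ?a (Suc n) k)"
    by (subst sum.atMost_Suc_shift) simp
  finally show ?case .
qed simp

text \<open>The binomial formula is applied to \<open>f ^^ (p ^ n)\<close>, which differs from the
  identity by \<open>D ^^ (p ^ n)\<close> by induction; the inner coefficients
  \<open>p choose k\<close> vanish in the field.\<close>

lemma lin_freshmans_dream:
  fixes f :: "'a::field \<times> 'a \<times> 'a \<Rightarrow> 'a \<times> 'a \<times> 'a"
  assumes f: "lin f" and D: "\<And>v. f v = v + D v" and p: "prime p" "of_nat p = (0 :: 'a)"
  shows "(f ^^ (p ^ n)) v = v + (D ^^ (p ^ n)) v"
proof (induction n arbitrary: v)
  case (Suc n)
  let ?f = "f ^^ (p ^ n)" let ?D = "D ^^ (p ^ n)"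
  have pp: "p > 0" using p prime_gt_0_nat by blast
  have "(?f ^^ p) v = (\<Sum>k\<le>p. sc (of_nat (p choose k)) ((?D ^^ k) v))"
    by (rule lin_funpow_binomial[OF lin_funpow[OF f] Suc])
  also have "\<dots> = (\<Sum>k\<in>{0, p}. sc (of_nat (p choose k)) ((?D ^^ k) v))"
  proof (rule sum.mono_neutral_right; (intro ballI)?)
    fix k assume "k \<in> {..p} - {0, p}"
    then have "p dvd p choose k" using p by (intro dvd_choose_prime) auto
    then have "of_nat (p choose k) = (0 :: 'a)" using p(2) by (metis dvdE mult_zero_left of_nat_mult)
    then show "sc (of_nat (p choose k)) ((?D ^^ k) v) = 0" by simp
  qed auto
  also have "\<dots> = v + (?D ^^ p) v" using pp by simp
  finally show ?case by (simp add: funpow_mult mult.commute)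
qed (simp add: D)

fun act :: "'a::comm_ring_1 mat \<Rightarrow> 'a \<times> 'a \<times> 'a \<Rightarrow> 'a \<times> 'a \<times> 'a" where
  "act A (x, y, z) = (A $$ (0, 0) * x + A $$ (0, Suc 0) * y + A $$ (0, 2) * z,
     A $$ (Suc 0, 0) * x + A $$ (Suc 0, Suc 0) * y + A $$ (Suc 0, 2) * z,
     A $$ (2, 0) * x + A $$ (2, Suc 0) * y + A $$ (2, 2) * z)"

lemma act_mult:
  "A \<in> carrier_mat 3 3 \<Longrightarrow> B \<in> carrier_mat 3 3 \<Longrightarrow> act (A * B) v = act A (act B v)"
  by (elim m3_cases; cases v) (simp add: algebra_simps)

lemma act_one [simp]: "act (1\<^sub>m 3) v = v"
  by (cases v) (simp add: one_mat_3)

lemma lin_act: "lin (act A)"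
  unfolding lin_def by (auto simp: sc_def algebra_simps)

lemma act_sc: "act A (sc c v) = sc c (act A v)"
  by (rule linD(2)[OF lin_act])

lemma act_eq_id:
  assumes "A \<in> carrier_mat 3 3" "\<And>v. act A v = v"
  shows "A = 1\<^sub>m 3"
  using assms(2)[of "(1, 0, 0)"] assms(2)[of "(0, 1, 0)"] assms(2)[of "(0, 0, 1)"]
  by (subst m3_eta[OF assms(1)]) (simp add: one_mat_3)

context unitary_field begin

fun herm :: "'a \<times> 'a \<times> 'a \<Rightarrow> 'a \<times> 'a \<times> 'a \<Rightarrow> 'a" where
  "herm (x, y, z) (x', y', z') = x * cj z' + y * cj y' + z * cj x'"

lemma herm_diff: "herm (u - v) w = herm u w - herm v w"
  by (cases u; cases v; cases w) (simp add: algebra_simps)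

text \<open>Expanding the left side, the coefficients are the nine entries of
  \<open>adj A * A\<close>, the identity matrix.\<close>

lemma herm_act:
  assumes "A \<in> carrier SUJ"
  shows "herm (act A u) (act A v) = herm u v"
proof -
  obtain a b c d e f g h i where Am: "A = m3 a b c d e f g h i"
    using m3_cases[OF SUJ_D(1)[OF assms]] .
  have eqs: "cj i * a + cj f * d + cj c * g = 1" "cj i * b + cj f * e + cj c * h = 0"
    "cj i * c + cj f * f + cj c * i = 0" "cj h * a + cj e * d + cj b * g = 0"
    "cj h * b + cj e * e + cj b * h = 1" "cj h * c + cj e * f + cj b * i = 0"
    "cj g * a + cj d * d + cj a * g = 0" "cj g * b + cj d * e + cj a * h = 0"
    "cj g * c + cj d * f + cj a * i = 1"
    using SUJ_D(3)[OF assms] by (simp_all add: Am one_mat_3)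
  obtain x y z x' y' z' where uv: "u = (x, y, z)" "v = (x', y', z')" by (cases u; cases v) auto
  have "herm (act A u) (act A v)
     = (cj i * a + cj f * d + cj c * g) * (x * cj z') + (cj i * b + cj f * e + cj c * h) * (y * cj z')
     + (cj i * c + cj f * f + cj c * i) * (z * cj z') + (cj h * a + cj e * d + cj b * g) * (x * cj y')
     + (cj h * b + cj e * e + cj b * h) * (y * cj y') + (cj h * c + cj e * f + cj b * i) * (z * cj y')
     + (cj g * a + cj d * d + cj a * g) * (x * cj x') + (cj g * b + cj d * e + cj a * h) * (y * cj x')
     + (cj g * c + cj d * f + cj a * i) * (z * cj x')"
    by (simp add: Am uv algebra_simps)
  then show ?thesis unfolding eqs by (simp add: uv)
qed

text \<open>A case of Witt's theorem: if the last coordinate \<open>z\<close> is nonzero,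
  \<open>weyl 1\<close> sends the first basis vector to the third, and a unitriangular element sends
  that to \<open>w\<close> divided by \<open>z\<close>.\<close>

lemma singular_transitive:
  assumes w: "w \<noteq> 0" "herm w w = 0"
  obtains B c where "B \<in> carrier SUJ" "c \<noteq> 0" "act B (1, 0, 0) = sc c w"
proof -
  obtain x y z where wm: "w = (x, y, z)" by (cases w)
  have h: "x * cj z + y * cj y + z * cj x = 0" using w by (simp add: wm)
  show thesis
  proof (cases "z = 0")
    case True
    then have "y = 0" "x \<noteq> 0" using h w by (auto simp: wm zero_prod_def)
    moreover have "1\<^sub>m 3 \<in> carrier SUJ" using G.one_closed by simp
    ultimately show ?thesis using that[of "1\<^sub>m 3" "1 / x"] True by (simp add: wm sc_def)
  next
    case False
    have "x / z + cj (x / z) = - (y / z * cj (y / z))"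
      using h False by (simp add: divide_simps) (simp add: eq_neg_iff_add_eq_0 ac_simps)
    then have U: "upp (y / z) (x / z) \<in> carrier SUJ" by (simp add: upp_SUJ_iff)
    moreover have "weyl 1 \<in> carrier SUJ" by (simp add: weyl_SUJ)
    ultimately have "upp (y / z) (x / z) * weyl 1 \<in> carrier SUJ" by (rule SUJ_mult)
    then show ?thesis
      using that[of "upp (y / z) (x / z) * weyl 1" "1 / z"] False
      by (simp add: wm sc_def upp_def weyl_def)
  qed
qed

text \<open>If \<open>A\<close> is unipotent, the last nonzero vector \<open>w\<close> of a chain \<open>(A - 1)\<^sup>k v\<close> is fixed and lies in the
  image of \<open>A - 1\<close>, which is orthogonal to all fixed vectors; so \<open>w\<close> is singular.\<close>

lemma p_element_conj_upp:
  assumes A: "A \<in> carrier SUJ" and A1: "A \<noteq> 1\<^sub>m 3" and pow: "A [^]\<^bsub>SUJ\<^esub> (p ^ n) = 1\<^sub>m 3"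
  obtains B \<alpha> \<beta> where "B \<in> carrier SUJ" "upp \<alpha> \<beta> \<in> carrier SUJ" "A = G.conj_by B (upp \<alpha> \<beta>)"
proof -
  have Ac: "A \<in> carrier_mat 3 3" using SUJ_D[OF A] by simp
  define D where "D = (\<lambda>v. act A v - v)"
  have actpow: "act (A [^]\<^bsub>SUJ\<^esub> k) v = (act A ^^ k) v" for k v
  proof (induction k arbitrary: v)
    case (Suc k)
    have "A [^]\<^bsub>SUJ\<^esub> k \<in> carrier_mat 3 3" using G.nat_pow_closed[OF A] SUJ_D by blast
    then show ?case using Suc Ac by (simp add: act_mult funpow_swap1)
  qed simp
  have nil: "(D ^^ (p ^ n)) v = 0" for v
  proof -
    have "(act A ^^ (p ^ n)) v = v + (D ^^ (p ^ n)) v"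
      by (rule lin_freshmans_dream[OF lin_act _ p of_nat_p]) (simp add: D_def)
    then show ?thesis using actpow[of "p ^ n" v] pow by simp
  qed
  obtain v where v: "D v \<noteq> 0"
    using act_eq_id[OF Ac] A1 by (auto simp: D_def)
  define m where "m = (LEAST k. (D ^^ k) v = 0)"
  have m: "(D ^^ m) v = 0" unfolding m_def by (rule LeastI[of _ "p ^ n"]) (rule nil)
  have min: "(D ^^ k) v \<noteq> 0" if "k < m" for k using not_less_Least[of k] that unfolding m_def by blast
  have D0: "D 0 = 0" by (simp add: D_def lin_zero[OF lin_act])
  \<comment> \<open>\<open>D v\<close> is nonzero, so the chain has length at least 2 and its last
    nonzero member \<open>w\<close> is the image under \<open>D\<close> of an earlier one.\<close>
  have "m \<noteq> 0" using m v D0 by (metis funpow_0)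
  moreover have "m \<noteq> 1" using m v by auto
  ultimately obtain k where k: "m = Suc (Suc k)" by (metis One_nat_def not0_implies_Suc)
  define u where "u = (D ^^ k) v"
  define w where "w = D u"
  have w: "w \<noteq> 0" using min[of "Suc k"] k by (simp add: w_def u_def)
  have "D w = 0" using m k by (simp add: w_def u_def)
  then have fix_w: "act A w = w" by (simp add: D_def)
  have "herm w w = herm (act A u) (act A w) - herm u w"
    by (simp add: fix_w) (simp add: w_def D_def herm_diff)
  then have "herm w w = 0" using herm_act[OF A] by simp
  then obtain B c where B: "B \<in> carrier SUJ" "c \<noteq> 0" "act B (1, 0, 0) = sc c w"
    using singular_transitive w by metis
  define A' where "A' = G.conj_by (adj B) A"
  have A'c: "A' \<in> carrier SUJ" using B A SUJ_adj by (simp add: A'_def)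
  have "A' = adj B * A * B" using B SUJ_D[OF B(1)] by (simp add: A'_def conj_by_SUJ SUJ_adj)
  then have "act A' (1, 0, 0) = act (adj B) (act A (act B (1, 0, 0)))"
    using SUJ_D[OF B(1)] Ac by (simp add: act_mult mult_carrier_mat[of _ 3 3 _ 3] del: act.simps)
  also have "act A (act B (1, 0, 0)) = act B (1, 0, 0)" by (simp add: B(3) act_sc fix_w del: act.simps)
  also have "act (adj B) (act B (1, 0, 0)) = (1, 0, 0)"
    using act_mult[of "adj B" B "(1, 0, 0)"] SUJ_D[OF B(1)] by (simp del: act.simps)
  finally have "A' $$ (0, 0) = 1" "A' $$ (2, 0) = 0" by auto
  then have "\<exists>b c d e f h i. A' = m3 1 b c d e f 0 h i"
    using m3_eta[OF SUJ_D(1)[OF A'c]] by metis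
  then obtain \<alpha> \<beta> where u: "A' = upp \<alpha> \<beta>" using upper_SUJ A'c by metis
  have "G.conj_by B A' = A"
    using G.conj_by_inv_cancel[of "adj B" A] A B SUJ_inv[OF SUJ_adj[OF B(1)]] SUJ_D[OF B(1)]
    by (simp add: A'_def SUJ_adj)
  then show thesis using that B A'c u by metis
qed


section \<open>The centre, and involutions in characteristic 2\<close>

lemma SUJ_assoc:
  "\<lbrakk>x \<in> carrier SUJ; y \<in> carrier SUJ; z \<in> carrier SUJ\<rbrakk> \<Longrightarrow> x * y * z = x * (y * z)"
  using G.m_assoc by simp

lemma three_neq_0: "p \<noteq> 3 \<Longrightarrow> (3 :: 'a) \<noteq> 0"
proof -
  assume "p \<noteq> 3"
  moreover have "prime (3 :: nat)" by simp
  ultimately have "\<not> p dvd 3" using p primes_dvd_imp_eq by blast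
  then show ?thesis using of_nat_eq_0_iff_char_dvd[of 3, where ?'a = 'a] CHAR by simp
qed

text \<open>Commuting with opposite transvections and with one regular unipotent forces a scalar
  matrix, with \<open>a * a * a = 1\<close> by the determinant. In characteristic 3 this reads
  \<open>(a - 1) ^ 3 = 0\<close>.\<close>

lemma center_SUJ:
  assumes z: "z \<in> carrier SUJ" and cen: "\<And>x. x \<in> carrier SUJ \<Longrightarrow> z * x = x * z"
  shows "z * z * z = 1\<^sub>m 3" and "p = 3 \<Longrightarrow> z = 1\<^sub>m 3"
proof -
  obtain a b c d e f g h i where zm: "z = m3 a b c d e f g h i"
    using m3_cases[OF SUJ_D(1)[OF z]] .
  obtain y where "cj y \<noteq> y" using exists_not_fixed by blast
  define l where "l = y - cj y"
  have l: "l \<noteq> 0" "upp 0 l \<in> carrier SUJ" using \<open>cj y \<noteq> y\<close> by (auto simp: l_def upp_SUJ_iff)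
  have l2: "low 0 l \<in> carrier SUJ"
    using G.conj_by_closed[of "weyl 1" "upp 0 l"] conj_by_weyl_upp[of 1 0 l] l by (simp add: weyl_SUJ)
  \<comment> \<open>Dividing an element of nonzero trace by minus its trace supplies the \<beta>
    needed for a unitriangular element with \<alpha> = 1.\<close>
  obtain x where x: "x ^ 3 + cj (x ^ 3) \<noteq> 0" using exists_cube_trace by blast
  define T where "T = x ^ 3 + cj x ^ 3"
  have T: "T \<noteq> 0" "cj T = T" using x by (simp_all add: T_def add.commute)
  have "- (x ^ 3) / T + cj (- (x ^ 3) / T) = - 1"
    using T by (simp add: field_simps) (simp add: T_def)
  then have u: "upp 1 (- (x ^ 3) / T) \<in> carrier SUJ" by (simp add: upp_SUJ_iff)
  have "z * upp 0 l = upp 0 l * z" by (rule cen[OF l(2)])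
  then have z1: "g = 0" "h = 0" "d = 0" "a * l = l * i" using l(1) by (simp_all add: zm upp_def)
  have "z * low 0 l = low 0 l * z" by (rule cen[OF l2])
  then have z2: "b = 0" "c = 0" "f = 0" using l(1) by (simp_all add: zm low_def)
  have "z * upp 1 (- (x ^ 3) / T) = upp 1 (- (x ^ 3) / T) * z" by (rule cen[OF u])
  then have "a = e" using z1 z2 by (simp add: zm upp_def)
  moreover have "a = i" using z1(4) l(1) by (simp add: mult.commute)
  ultimately have z3: "z = m3 a 0 0 0 a 0 0 0 a" using z1 z2 by (simp add: zm)
  then have a3: "a * a * a = 1" using SUJ_D(4)[OF z] by (simp add: det_m3 mult.assoc)
  then show "z * z * z = 1\<^sub>m 3" by (simp add: z3 one_mat_3)
  assume "p = 3"
  then have "(3 :: 'a) = 0" using of_nat_p by simp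
  moreover have "(a - 1) ^ 3 = a * a * a - 1 - 3 * (a * a - a)"
    by (simp add: power3_eq_cube algebra_simps)
  ultimately have "a = 1" using a3 by simp
  then show "z = 1\<^sub>m 3" by (simp add: z3 one_mat_3)
qed

text \<open>Commuting with a transvection preserves its fixed line, and \<open>a * a = 1\<close>
  makes the eigenvalue there 1, so \<open>a\<close> is some \<open>upp \<alpha> \<beta>'\<close>; in
  characteristic 2 its square is \<open>upp 0 (- (cj \<alpha> * \<alpha>))\<close>.\<close>

lemma involution_commuting:
  assumes p2: "p = 2" and a: "a \<in> carrier SUJ" "a * a = 1\<^sub>m 3" and b: "\<beta> \<noteq> 0"
    and com: "a * upp 0 \<beta> = upp 0 \<beta> * a"
  obtains \<beta>' where "a = upp 0 \<beta>'"
proof -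
  have two: "(2 :: 'a) = 0" using p2 two_eq_0_iff by simp
  obtain r b c d e f g h i where am: "a = m3 r b c d e f g h i"
    using m3_cases[OF SUJ_D(1)[OF a(1)]] .
  have z: "d = 0" "g = 0" "h = 0" "r = i"
    using com b by (auto simp: am upp_def)
  then have "r * r = 1" using a(2) by (simp add: am one_mat_3)
  then have "(r - 1) * (r - 1) = 2 * (1 - r)" by (simp add: algebra_simps)
  then have "r = 1" using two by simp
  then obtain \<alpha> \<beta>' where u: "a = upp \<alpha> \<beta>'"
    using upper_SUJ[of b c d e f h i] a(1) z by (metis am)
  have "\<alpha> * cj \<alpha> = 0" using a(2) two by (simp add: u upp_mult one_eq_upp mult.commute flip: mult_2)
  then show thesis using that u by auto
qed

lemma uminus_eq:
  assumes "p = 2"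
  shows "- x = (x :: 'a)"
proof -
  have "2 * x = 0" using assms two_eq_0_iff by simp
  then show ?thesis by (simp only: mult_2 neg_eq_iff_add_eq_0)
qed

text \<open>The product \<open>x = a * b\<close> is inverted by \<open>a\<close> and turns out to be
  unitriangular. Either \<open>x\<close> or \<open>x * x\<close> is a nontrivial transvection equal
  to its own inverse, so \<open>a\<close> commutes with it and \<open>involution_commuting\<close>
  applies.\<close>

lemma involution_product:
  assumes p2: "p = 2" and a: "a \<in> carrier SUJ" "a * a = 1\<^sub>m 3" and b: "b \<in> carrier SUJ" "b * b = 1\<^sub>m 3"
    and ab: "a \<noteq> b" and be: "\<beta> \<noteq> 0"
    and com: "(a * b) * upp 0 \<beta> = upp 0 \<beta> * (a * b)"
  obtains \<beta>\<^sub>1 \<beta>\<^sub>2 where "a = upp 0 \<beta>\<^sub>1" "b = upp 0 \<beta>\<^sub>2"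
proof -
  have two: "(2 :: 'a) = 0" using p2 two_eq_0_iff by simp
  have double: "u + u = 0" for u :: 'a using two by (metis mult_2 mult_zero_left)
  define x where "x = a * b"
  have x: "x \<in> carrier SUJ" using a b by (simp add: x_def SUJ_mult)
  have adja: "adj a = a" "adj b = b"
    using SUJ_inv[of a] SUJ_inv[of b] G.inv_equality[of a a] G.inv_equality[of b b] a b by simp_all
  have adjx: "adj x = b * a" using SUJ_D(1)[OF a(1)] SUJ_D(1)[OF b(1)] by (simp add: x_def adj_mult adja)
  have ax: "a * x = b" using SUJ_cancel(1)[OF a(1), of b] b by (simp add: x_def adja SUJ_D)
  have axa: "a * x * a = adj x" by (simp add: ax adjx)
  obtain m s t d n f g h i where xm: "x = m3 m s t d n f g h i"
    using m3_cases[OF SUJ_D(1)[OF x]] .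
  have z: "d = 0" "g = 0" "h = 0" "m = i"
    using com be by (auto simp: xm upp_def simp flip: x_def)
  have nn: "i * cj i = 1" "n * cj n = 1"
    using SUJ_D(2)[OF x] by (simp_all add: xm z one_mat_3)
  \<comment> \<open>The traces of \<open>a * b\<close> and \<open>b * a\<close> agree; in
    characteristic 2 the two equal outer diagonal entries cancel, leaving
    \<open>n = cj n\<close>.\<close>
  have "x $$ (0, 0) + x $$ (Suc 0, Suc 0) + x $$ (2, 2)
      = adj x $$ (0, 0) + adj x $$ (Suc 0, Suc 0) + adj x $$ (2, 2)"
    unfolding adjx unfolding x_def using SUJ_D(1)[OF a(1)] SUJ_D(1)[OF b(1)]
    by (elim m3_cases) (simp add: algebra_simps)
  then have "n + (i + i) = cj n + (cj i + cj i)" by (simp add: xm z algebra_simps)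
  then have "cj n = n" by (simp add: double)
  then have "(n - 1) * (n - 1) = 2 * (1 - n)" using nn by (simp add: algebra_simps)
  then have n: "n = 1" using two by simp
  then have "i * i = 1" using SUJ_D(4)[OF x] by (simp add: xm z det_m3)
  then have "(i - 1) * (i - 1) = 2 * (1 - i)" by (simp add: algebra_simps)
  then have "i = 1" using two by simp
  then obtain \<alpha> \<gamma> where u: "x = upp \<alpha> \<gamma>"
    using upper_SUJ[of s t d n f h i] x z by (metis xm)
  have tr: "\<gamma> + cj \<gamma> = - (\<alpha> * cj \<alpha>)" using x by (simp add: u upp_SUJ_iff)
  have inverted: "\<exists>\<beta>'. a = upp 0 \<beta>'" if y: "y \<in> carrier SUJ" "y = upp 0 \<delta>" "\<delta> \<noteq> 0" "a * y * a = y" for y \<delta>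
  proof -
    have "a * y = a * y * (a * a)" using a right_mult_one_mat[OF SUJ_D(1)[OF SUJ_mult[OF a(1) y(1)]]] by simp
    also have "\<dots> = a * y * a * a"
      by (rule SUJ_assoc[OF SUJ_mult[OF a(1) y(1)] a(1) a(1), symmetric])
    finally have "a * y = y * a" using y(4) by simp
    then show ?thesis using involution_commuting[OF p2 a y(3)] y(2) by metis
  qed
  have x1: "x \<noteq> 1\<^sub>m 3"
  proof
    assume "x = 1\<^sub>m 3"
    then have "b = a * 1\<^sub>m 3" using ax by simp
    then show False using ab SUJ_D(1)[OF a(1)] by simp
  qed
  have al: "\<alpha> = 0"
  proof (rule ccontr)
    assume al: "\<alpha> \<noteq> 0"
    have xx: "x * x = upp 0 (- (cj \<alpha> * \<alpha>))" by (simp add: u upp_mult double)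
    have "a * (x * x) * a = (a * x) * (x * a)" using a(1) x by (simp add: SUJ_assoc SUJ_mult)
    also have "\<dots> = (b * a) * (b * a)"
      unfolding ax using a(1) b(1) by (simp add: x_def SUJ_assoc SUJ_mult)
    also have "\<dots> = adj (x * x)" using SUJ_D(1)[OF x] by (simp add: adjx[symmetric] adj_mult)
    also have "\<dots> = x * x" by (simp add: xx adj_upp mult.commute)
    finally obtain \<beta>' where a': "a = upp 0 \<beta>'"
      using inverted[of "x * x" "- (cj \<alpha> * \<alpha>)"] SUJ_mult[OF x x] xx al by auto
    \<comment> \<open>With \<open>a\<close> a transvection, \<open>b = a * x\<close> has nonzero
      first parameter, so it cannot be an involution.\<close>
    have "b = upp \<alpha> (\<beta>' + \<gamma>)" using ax by (simp add: a' u upp_mult)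
    then show False using b(2) al by (simp add: upp_mult one_eq_upp double)
  qed
  then have "cj \<gamma> = - \<gamma>" using tr by (simp add: add_eq_0_iff)
  then have "cj \<gamma> = \<gamma>" using uminus_eq[OF p2] by simp
  then have "a * x * a = x" using al by (simp add: axa) (simp add: u adj_upp)
  moreover have "\<gamma> \<noteq> 0" using x1 al by (simp add: u one_eq_upp)
  ultimately obtain \<beta>' where a': "a = upp 0 \<beta>'" using inverted[OF x] u al by blast
  have "b = upp 0 (\<beta>' + \<gamma>)" using ax al by (simp add: a' u upp_mult)
  then show thesis using that a' by blast
qed

lemma unipotent_order_two:
  assumes "upp \<alpha> \<beta> \<noteq> 1\<^sub>m 3"
  shows "upp \<alpha> \<beta> * upp \<alpha> \<beta> = 1\<^sub>m 3 \<longleftrightarrow> p = 2 \<and> \<alpha> = 0"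
proof -
  have "upp \<alpha> \<beta> * upp \<alpha> \<beta> = 1\<^sub>m 3 \<longleftrightarrow> 2 * \<alpha> = 0 \<and> 2 * \<beta> = cj \<alpha> * \<alpha>"
    by (simp only: upp_mult one_eq_upp upp_eq_iff mult_2 right_minus_eq)
  then show ?thesis using assms two_eq_0_iff by (auto simp: one_eq_upp)
qed

end

section \<open>Quotients by central subgroups\<close>

context group begin

lemma ord_eq_2_iff:
  assumes "g \<in> carrier G" "g \<noteq> \<one>"
  shows "ord g = 2 \<longleftrightarrow> g \<otimes> g = \<one>"
proof -
  have "g \<otimes> g = \<one> \<longleftrightarrow> ord g dvd 2"
    using assms pow_eq_id[of g 2] by (simp add: numeral_2_eq_2)
  moreover have "ord g \<noteq> 1" using assms ord_eq_1 by simp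
  ultimately show ?thesis by (metis One_nat_def dvd_refl prime_nat_iff two_is_prime_nat)
qed

end

text \<open>One setting for both groups: \<open>SU3 q\<close>, where the map is injective, and
  \<open>PSU3 q\<close>, where the kernel is the centre.\<close>

locale unitary_quotient = unitary_field p q ty + H: group H
  for p q :: nat and ty :: "'a::field itself" and H :: "('h, 'm) monoid_scheme" (structure) +
  fixes \<psi> :: "'a mat \<Rightarrow> 'h"
  assumes hom: "\<psi> \<in> hom SUJ H" and surj: "\<psi> ` carrier SUJ = carrier H"
    and kernel_central: "\<And>z x. \<lbrakk>z \<in> carrier SUJ; \<psi> z = \<one>; x \<in> carrier SUJ\<rbrakk> \<Longrightarrow> z * x = x * z"
begin

sublocale \<psi>: group_hom SUJ H \<psi>
  by unfold_locales (rule hom)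

lemma psi_mult: "x \<in> carrier SUJ \<Longrightarrow> y \<in> carrier SUJ \<Longrightarrow> \<psi> (x * y) = \<psi> x \<otimes> \<psi> y"
  using \<psi>.hom_mult by simp

lemma psi_one: "\<psi> (1\<^sub>m 3) = \<one>"
  using \<psi>.hom_one by simp

lemma psi_conj_by: "x \<in> carrier SUJ \<Longrightarrow> y \<in> carrier SUJ \<Longrightarrow> \<psi> (G.conj_by x y) = H.conj_by (\<psi> x) (\<psi> y)"
  unfolding G.conj_by_def H.conj_by_def by (simp add: psi_mult SUJ_mult SUJ_inv SUJ_adj \<psi>.hom_inv[symmetric])

lemma kernel_cube: "z \<in> carrier SUJ \<Longrightarrow> \<psi> z = \<one> \<Longrightarrow> z * z * z = 1\<^sub>m 3"
  "z \<in> carrier SUJ \<Longrightarrow> \<psi> z = \<one> \<Longrightarrow> p = 3 \<Longrightarrow> z = 1\<^sub>m 3"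
  using center_SUJ[of z] kernel_central by auto

lemma kernel_square:
  assumes "z \<in> carrier SUJ" "\<psi> z = \<one>" "z * z = 1\<^sub>m 3"
  shows "z = 1\<^sub>m 3"
  using kernel_cube(1)[OF assms(1,2)] assms(3) SUJ_D(1)[OF assms(1)] by simp

text \<open>For p = 3 the kernel is trivial; otherwise the cube of the element is 1 and 3 is
  invertible in the field.\<close>

lemma kernel_upp:
  assumes "upp \<alpha> \<beta> \<in> carrier SUJ" "\<psi> (upp \<alpha> \<beta>) = \<one>"
  shows "upp \<alpha> \<beta> = 1\<^sub>m 3"
proof (cases "p = 3")
  case False
  have "3 * \<alpha> = 0" using kernel_cube(1)[OF assms] by (simp add: upp_mult one_eq_upp)
  then have a: "\<alpha> = 0" using three_neq_0[OF False] by simp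
  have "3 * \<beta> = 0" using kernel_cube(1)[OF assms] by (simp add: upp_mult one_eq_upp a)
  then show ?thesis using three_neq_0[OF False] by (simp add: one_eq_upp a)
qed (use kernel_cube(2)[OF assms] in simp)

text \<open>The kernel has exponent dividing \<open>3\<close>, and \<open>3\<close> divides one of \<open>1 + P\<close>, \<open>1 + 2 P\<close> when the prime
  power \<open>P\<close> is prime to \<open>3\<close>; so some \<open>a\<^bsup>1 + t P\<^esup>\<close> over the same element has order dividing \<open>P\<close>.\<close>

lemma lift_p_element:
  assumes g: "g \<in> carrier H" "H.ord g = p ^ k"
  obtains a where "a \<in> carrier SUJ" "\<psi> a = g" "a [^]\<^bsub>SUJ\<^esub> (p ^ k) = 1\<^sub>m 3"
proof -
  have "g \<in> \<psi> ` carrier SUJ" using g(1) surj by simp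
  then obtain a where a: "a \<in> carrier SUJ" "\<psi> a = g" by (auto elim: imageE)
  let ?P = "p ^ k"
  let ?z = "a [^]\<^bsub>SUJ\<^esub> ?P"
  have z: "?z \<in> carrier SUJ" using a by simp
  have gP: "g [^] ?P = \<one>" using H.pow_ord_eq_1[OF g(1)] g(2) by simp
  then have pz: "\<psi> ?z = \<one>" using \<psi>.hom_nat_pow[OF a(1)] a(2) by simp
  show thesis
  proof (cases "p = 3")
    case True
    then show ?thesis using that a kernel_cube(2)[OF z pz] by blast
  next
    case False
    have z3: "?z [^]\<^bsub>SUJ\<^esub> (3 :: nat) = 1\<^sub>m 3"
      using kernel_cube(1)[OF z pz] z SUJ_D(1)[OF z] by (simp add: numeral_3_eq_3)
    have "\<not> 3 dvd ?P"
    proof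
      assume "3 dvd ?P"
      moreover have "prime (3 :: nat)" by simp
      ultimately have "3 dvd p" using prime_dvd_power by blast
      then show False using \<open>prime (3 :: nat)\<close> p False primes_dvd_imp_eq by blast
    qed
    then have "\<exists>t. 3 dvd 1 + t * ?P"
    proof -
      assume "\<not> 3 dvd ?P"
      then have "3 dvd 1 + 2 * ?P \<or> 3 dvd 1 + 1 * ?P" by presburger
      then show ?thesis by blast
    qed
    then obtain t j where tj: "1 + t * ?P = 3 * j" by (auto elim: dvdE)
    let ?b = "a [^]\<^bsub>SUJ\<^esub> (1 + t * ?P)"
    have "\<psi> ?b = g [^] (1 + t * ?P)" by (simp only: \<psi>.hom_nat_pow[OF a(1)] a(2))
    also have "\<dots> = g \<otimes> (g [^] ?P) [^] t"
      using g(1) by (simp only: H.nat_pow_mult[symmetric] H.nat_pow_pow mult.commute[of t] H.nat_pow_eone)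
    also have "\<dots> = g" using g gP by simp
    finally have "\<psi> ?b = g" .
    moreover have "?b [^]\<^bsub>SUJ\<^esub> ?P = (?z [^]\<^bsub>SUJ\<^esub> (3 :: nat)) [^]\<^bsub>SUJ\<^esub> j"
      unfolding tj using a by (simp add: G.nat_pow_pow ac_simps)
    then have "?b [^]\<^bsub>SUJ\<^esub> ?P = 1\<^sub>m 3" using z3 G.nat_pow_one[of j] by simp
    ultimately show ?thesis using that[of ?b] G.nat_pow_closed[OF a(1)] by blast
  qed
qed

text \<open>The stabiliser of the component is pulled back along \<psi> to the subgroup
  \<open>M\<close>, to which \<open>subgroup_full\<close> applies.\<close>

lemma irreducible:
  assumes c0: "upp \<kappa> \<beta> \<in> carrier SUJ" "upp \<kappa> \<beta> \<noteq> 1\<^sub>m 3" and not2: "\<not> (p = 2 \<and> \<kappa> = 0)"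
  shows "killing_irreducible H (conj_class H (\<psi> (upp \<kappa> \<beta>)))"
proof -
  let ?c = "\<psi> (upp \<kappa> \<beta>)"
  have fin: "finite (carrier H)" using surj finite_SUJ finite_imageI by metis
  have c: "?c \<in> carrier H" using c0 by simp
  define M where "M = {h \<in> carrier SUJ. \<psi> h \<in> H.killing_stab ?c}"
  have stab: "subgroup (H.killing_stab ?c) H" by (rule H.subgroup_killing_stab[OF fin c])
  have M: "subgroup M SUJ"
    by (rule G.finite_order_inv_closed_subgroup[OF finite_SUJ])
      (use subgroup.m_closed[OF stab] subgroup.one_closed[OF stab] in
        \<open>auto simp: M_def psi_mult psi_one SUJ_mult simp flip: SUJ_simps(2)\<close>)
  have MI: "A \<in> M" if A: "A \<in> carrier SUJ" and B: "B \<in> carrier SUJ"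
    and com: "G.conj_by B (upp \<kappa> \<beta>) * (upp \<kappa> \<beta> * G.conj_by A (upp \<kappa> \<beta>))
      = upp \<kappa> \<beta> * G.conj_by A (upp \<kappa> \<beta>) * G.conj_by B (upp \<kappa> \<beta>)" for A B
  proof -
    have "\<psi> (G.conj_by B (upp \<kappa> \<beta>) * (upp \<kappa> \<beta> * G.conj_by A (upp \<kappa> \<beta>)))
      = \<psi> (upp \<kappa> \<beta> * G.conj_by A (upp \<kappa> \<beta>) * G.conj_by B (upp \<kappa> \<beta>))"
      using com by simp
    then have "\<psi> A \<in> H.killing_stab ?c"
      using A B c0 by (intro H.killing_stabI[of _ _ "\<psi> B"]) (simp_all add: psi_mult SUJ_mult psi_conj_by)
    then show ?thesis using A by (simp add: M_def)
  qed
  \<comment> \<open>The witness is the class member \<open>upp \<kappa> \<beta>\<close> itself: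
    unitriangular elements with equal first parameter commute.\<close>
  have U: "upp \<xi> \<eta> \<in> M" if "upp \<xi> \<eta> \<in> carrier SUJ" for \<xi> \<eta>
  proof (rule MI[OF that])
    show "\<one>\<^bsub>SUJ\<^esub> \<in> carrier SUJ" by (rule G.one_closed)
    show "G.conj_by \<one>\<^bsub>SUJ\<^esub> (upp \<kappa> \<beta>) * (upp \<kappa> \<beta> * G.conj_by (upp \<xi> \<eta>) (upp \<kappa> \<beta>)) =
      upp \<kappa> \<beta> * G.conj_by (upp \<xi> \<eta>) (upp \<kappa> \<beta>) * G.conj_by \<one>\<^bsub>SUJ\<^esub> (upp \<kappa> \<beta>)"
      using c0 by (simp add: conj_by_upp_upp[OF that] G.conj_by_one upp_mult algebra_simps del: SUJ_simps(2))
  qed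
  obtain A B where AB: "A \<in> carrier SUJ" "B \<in> carrier SUJ" "A $$ (2, 0) \<noteq> 0"
    "G.conj_by B (upp \<kappa> \<beta>) * (upp \<kappa> \<beta> * G.conj_by A (upp \<kappa> \<beta>))
      = upp \<kappa> \<beta> * G.conj_by A (upp \<kappa> \<beta>) * G.conj_by B (upp \<kappa> \<beta>)"
  proof (cases "\<kappa> = 0")
    case True
    then have "\<beta> \<noteq> 0" "p \<noteq> 2" using c0(2) not2 by (auto simp: one_eq_upp)
    then show thesis using transvection_edge[of \<beta>] c0(1) that True by metis
  next
    case False
    show thesis using regular_edge[OF c0(1) False] that by metis
  qed
  have "M = carrier SUJ" by (rule subgroup_full[OF M U MI[OF AB(1,2,4)] AB(3)])
  then have "\<psi> ` carrier SUJ \<subseteq> H.killing_stab ?c" by (auto simp: M_def)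
  then have "H.killing_stab ?c = carrier H"
    using surj subgroup.subset[OF stab] by simp
  then show ?thesis by (rule H.killing_irreducible_if_stab[OF fin c])
qed

text \<open>The commutator \<open>z\<close> lies in the central kernel. Conjugating twice by the
  involution \<open>x\<close> gives \<open>z * z = 1\<close>, and the kernel has exponent dividing
  3.\<close>

lemma comm_lift:
  assumes x: "x \<in> carrier SUJ" "x * x = 1\<^sub>m 3" and y: "y \<in> carrier SUJ"
    and com: "\<psi> x \<otimes> \<psi> y = \<psi> y \<otimes> \<psi> x"
  shows "x * y = y * x"
proof -
  define z where "z = G.conj_by x y * adj y"
  have z: "z \<in> carrier SUJ" using x y by (simp add: z_def SUJ_mult SUJ_adj)
  have "\<psi> z = H.conj_by (\<psi> x) (\<psi> y) \<otimes> inv (\<psi> y)"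
    using x y by (simp add: z_def psi_mult psi_conj_by SUJ_adj SUJ_inv[symmetric])
  also have "H.conj_by (\<psi> x) (\<psi> y) = \<psi> y"
    using com x y by (simp add: H.conj_by_eq_self_iff)
  finally have pz: "\<psi> z = \<one>" using y by simp
  have zy: "G.conj_by x y = z * y"
    using x y by (simp add: z_def SUJ_assoc SUJ_adj SUJ_D)
      (metis G.conj_by_closed SUJ_D(1) right_mult_one_mat)
  have zx: "G.conj_by x z = z"
    using G.conj_by_eq_self_iff[OF x(1) z] kernel_central[OF z pz x(1)] by simp
  have "y = G.conj_by x (G.conj_by x y)"
    using G.conj_by_conj_by[of x x y] x y G.conj_by_one[OF y] by simp
  also have "\<dots> = z * (z * y)" using G.conj_by_mult[OF x(1) z y] zx zy by simp
  finally have "z * z * y = y" using z y by (simp add: SUJ_assoc)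
  then have "z * z = 1\<^sub>m 3" using G.r_cancel_one[of y "z * z"] z y SUJ_mult by simp
  then have "z = 1\<^sub>m 3" by (rule kernel_square[OF z pz])
  then have "G.conj_by x y = y" using zy left_mult_one_mat[OF SUJ_D(1)[OF y]] by simp
  then show ?thesis using G.conj_by_eq_self_iff[OF x(1) y] by simp
qed

text \<open>The hypotheses of \<open>killing_involutions\<close> are proved for the class
  \<open>C0\<close> upstairs, after conjugating one element to \<open>?c\<close>, and pass to the
  quotient by \<open>comm_lift\<close>.\<close>

lemma involutions:
  assumes p2: "p = 2" and c0: "upp 0 \<beta> \<in> carrier SUJ" and be: "\<beta> \<noteq> 0"
  shows "\<not> killing_irreducible H (conj_class H (\<psi> (upp 0 \<beta>)))"
    and "killing_nondegenerate H (conj_class H (\<psi> (upp 0 \<beta>)))"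
proof -
  let ?c = "upp 0 \<beta>"
  let ?C = "conj_class H (\<psi> ?c)"
  define C0 where "C0 = (\<lambda>h. G.conj_by h ?c) ` carrier SUJ"
  have C: "?C = \<psi> ` C0"
    using c0 by (force simp: C0_def H.conj_class_eq image_image psi_conj_by surj[symmetric])
  have C0c: "x \<in> carrier SUJ" if "x \<in> C0" for x using that c0 by (auto simp: C0_def)
  have cc: "?c * ?c = 1\<^sub>m 3"
    using p2 be unipotent_order_two[of 0 \<beta>] by (simp add: one_eq_upp)
  have sq: "x * x = 1\<^sub>m 3" if "x \<in> C0" for x
    using that G.conj_by_mult[OF _ c0 c0] cc G.conj_by_def by (auto simp: C0_def) (metis G.r_inv G.r_one SUJ_simps G.one_closed)
  have cl: "G.conj_by h x \<in> C0" if "h \<in> carrier SUJ" "x \<in> C0" for h x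
    using that c0 G.conj_by_conj_by[of h _ ?c] by (auto simp: C0_def SUJ_mult)
  have tr0: "a * c = c * a" if "a \<in> C0" "b \<in> C0" "c \<in> C0" "a * b = b * a" "b * c = c * b" for a b c
  proof -
    from that(2) obtain k where k: "k \<in> carrier SUJ" "b = G.conj_by k ?c" by (auto simp: C0_def)
    let ?i = "G.conj_by (adj k)"
    have ik: "adj k \<in> carrier SUJ" using k SUJ_adj by simp
    have ib: "?i b = ?c" using G.conj_by_inv_cancel[OF k(1) c0] k SUJ_inv by simp
    have mult: "?i (x * y) = ?i x * ?i y" if "x \<in> C0" "y \<in> C0" for x y
      using G.conj_by_mult[OF ik C0c C0c] that by simp
    have "?i a * ?c = ?c * ?i a" "?i c * ?c = ?c * ?i c"
      using mult[OF that(1,2)] mult[OF that(2,1)] mult[OF that(3,2)] mult[OF that(2,3)] that(4,5) ib by simp_all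
    moreover have "?i a \<in> C0" "?i c \<in> C0" using cl[OF ik] that by auto
    ultimately obtain \<beta>\<^sub>1 \<beta>\<^sub>2 where "?i a = upp 0 \<beta>\<^sub>1" "?i c = upp 0 \<beta>\<^sub>2"
      using involution_commuting[OF p2 _ _ be] C0c sq by metis
    then have "?i (a * c) = ?i (c * a)" using mult that by (simp add: upp_mult add.commute)
    then show ?thesis using G.conj_by_eq_iff[OF ik] that C0c SUJ_mult by simp
  qed
  have pr0: "a * b = b * a \<and> a * c = c * a"
    if "a \<in> C0" "b \<in> C0" "c \<in> C0" "a \<noteq> b" "c * (a * b) = (a * b) * c" for a b c
  proof -
    from that(3) obtain k where k: "k \<in> carrier SUJ" "c = G.conj_by k ?c" by (auto simp: C0_def)
    let ?i = "G.conj_by (adj k)"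
    have ik: "adj k \<in> carrier SUJ" using k SUJ_adj by simp
    have ic: "?i c = ?c" using G.conj_by_inv_cancel[OF k(1) c0] k SUJ_inv by simp
    have mult: "?i (x * y) = ?i x * ?i y" if "x \<in> carrier SUJ" "y \<in> carrier SUJ" for x y
      using G.conj_by_mult[OF ik that] by simp
    note car = C0c[OF that(1)] C0c[OF that(2)] C0c[OF that(3)]
    have com: "?i a * ?i b * ?c = ?c * (?i a * ?i b)"
      using mult[OF car(3) SUJ_mult[OF car(1,2)]] mult[OF SUJ_mult[OF car(1,2)] car(3)]
        mult[OF car(1,2)] that(5) ic by simp
    have "?i a \<noteq> ?i b" using that(4) G.conj_by_eq_iff[OF ik car(1,2)] by simp
    moreover have "?i a \<in> C0" "?i b \<in> C0" using cl[OF ik] that by auto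
    ultimately obtain \<beta>\<^sub>1 \<beta>\<^sub>2 where u: "?i a = upp 0 \<beta>\<^sub>1" "?i b = upp 0 \<beta>\<^sub>2"
      using involution_product[OF p2 _ _ _ _ _ be com] C0c sq by metis
    have "?i (a * b) = ?i (b * a)" "?i (a * c) = ?i (c * a)"
      using mult car by (simp_all add: u ic upp_mult add.commute)
    then show ?thesis using G.conj_by_eq_iff[OF ik] car SUJ_mult by simp
  qed
  have w: "weyl 1 \<in> carrier SUJ" by (simp add: weyl_SUJ)
  have nc0: "?c * G.conj_by (weyl 1) ?c \<noteq> G.conj_by (weyl 1) ?c * ?c"
    unfolding conj_by_weyl_upp[OF one_neq_zero] using be by (simp add: upp_def low_def)
  have c_mem: "?c \<in> C0" using c0 G.conj_by_one[OF c0] G.one_closed unfolding C0_def by (metis imageI)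
  have lift: "x * y = y * x" if "x \<in> C0" "y \<in> carrier SUJ" "\<psi> x \<otimes> \<psi> y = \<psi> y \<otimes> \<psi> x" for x y
    using comm_lift[OF C0c[OF that(1)] sq[OF that(1)]] that by blast
  have C1: "finite ?C" unfolding C C0_def using finite_SUJ by simp
  have C2: "?C \<subseteq> carrier H" unfolding C using C0c by auto
  have C3: "a \<otimes> a = \<one>" if "a \<in> ?C" for a
    using that unfolding C using C0c sq psi_mult psi_one by (metis imageE)
  have C4: "a \<otimes> c = c \<otimes> a" if "a \<in> ?C" "b \<in> ?C" "c \<in> ?C" "a \<otimes> b = b \<otimes> a" "b \<otimes> c = c \<otimes> b" for a b c
  proof -
    from that(1-3) obtain a' b' c'
      where l: "a' \<in> C0" "b' \<in> C0" "c' \<in> C0" "a = \<psi> a'" "b = \<psi> b'" "c = \<psi> c'"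
      unfolding C by blast
    then have "a' * c' = c' * a'"
      using tr0[OF l(1-3)] lift[OF l(1) C0c[OF l(2)]] lift[OF l(2) C0c[OF l(3)]] that(4,5) by simp
    then show ?thesis using l C0c psi_mult by metis
  qed
  have C5: "a \<otimes> b = b \<otimes> a \<and> a \<otimes> c = c \<otimes> a"
    if "a \<in> ?C" "b \<in> ?C" "c \<in> ?C" "a \<noteq> b" "c \<otimes> (a \<otimes> b) = (a \<otimes> b) \<otimes> c" for a b c
  proof -
    from that(1-3) obtain a' b' c'
      where l: "a' \<in> C0" "b' \<in> C0" "c' \<in> C0" "a = \<psi> a'" "b = \<psi> b'" "c = \<psi> c'"
      unfolding C by blast
    have "\<psi> c' \<otimes> \<psi> (a' * b') = \<psi> (a' * b') \<otimes> \<psi> c'"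
      using that(5) l C0c psi_mult by simp
    then have "c' * (a' * b') = (a' * b') * c'"
      using lift[OF l(3) SUJ_mult[OF C0c[OF l(1)] C0c[OF l(2)]]] by blast
    then have "a' * b' = b' * a' \<and> a' * c' = c' * a'" using pr0[OF l(1-3)] l that(4) by blast
    then show ?thesis using l C0c psi_mult by metis
  qed
  have C6: "\<exists>a\<in>?C. \<exists>b\<in>?C. a \<otimes> b \<noteq> b \<otimes> a"
    unfolding C using c_mem cl[OF w c_mem] nc0 lift[OF c_mem C0c[OF cl[OF w c_mem]]] by blast
  show "\<not> killing_irreducible H ?C" "killing_nondegenerate H ?C"
    by (rule H.killing_involutions[OF C1 C2 C3 C4 C5 C6]; assumption)+
qed

text \<open>Lifting and conjugating replaces \<open>g\<close> by the image of a unitriangular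
  element. Its order is 2 exactly when the lift squares to 1, by \<open>kernel_upp\<close>.\<close>

theorem killing_unipotent_class:
  assumes g: "g \<in> carrier H" "g \<noteq> \<one>" "H.ord g = p ^ k"
  shows "(killing_irreducible H (conj_class H g) \<longleftrightarrow> H.ord g \<noteq> 2)
    \<and> (H.ord g = 2 \<longrightarrow> killing_nondegenerate H (conj_class H g))"
proof -
  obtain a where a: "a \<in> carrier SUJ" "\<psi> a = g" "a [^]\<^bsub>SUJ\<^esub> (p ^ k) = 1\<^sub>m 3"
    using lift_p_element[OF g(1,3)] .
  have "a \<noteq> 1\<^sub>m 3" using a g psi_one by auto
  then obtain B \<alpha> \<beta> where B: "B \<in> carrier SUJ" and u: "upp \<alpha> \<beta> \<in> carrier SUJ"
    and aB: "a = G.conj_by B (upp \<alpha> \<beta>)"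
    using p_element_conj_upp[OF a(1) _ a(3)] by metis
  let ?c = "\<psi> (upp \<alpha> \<beta>)"
  have gc: "g = H.conj_by (\<psi> B) ?c" using a aB B u psi_conj_by by simp
  have cls: "conj_class H g = conj_class H ?c"
    unfolding gc using B u by (intro H.conj_class_conj_by) auto
  have u1: "upp \<alpha> \<beta> \<noteq> 1\<^sub>m 3"
    using gc g(2) B psi_one H.conj_by_def by auto
  have "H.ord g = 2 \<longleftrightarrow> H.conj_by (\<psi> B) (?c \<otimes> ?c) = \<one>"
    using H.ord_eq_2_iff[OF g(1,2)] B u by (simp add: gc[symmetric])
  also have "\<dots> \<longleftrightarrow> H.conj_by (\<psi> B) (?c \<otimes> ?c) = H.conj_by (\<psi> B) \<one>"
    using B by (simp add: H.conj_by_def)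
  also have "\<dots> \<longleftrightarrow> \<psi> (upp \<alpha> \<beta> * upp \<alpha> \<beta>) = \<one>"
    using B u H.conj_by_eq_iff[of "\<psi> B" "?c \<otimes> ?c" \<one>] by (simp add: psi_mult del: H.conj_by_mult)
  also have "\<dots> \<longleftrightarrow> upp \<alpha> \<beta> * upp \<alpha> \<beta> = 1\<^sub>m 3"
    using kernel_upp SUJ_mult[OF u u] psi_one unfolding upp_mult by metis
  also have "\<dots> \<longleftrightarrow> p = 2 \<and> \<alpha> = 0" by (rule unipotent_order_two[OF u1])
  finally have ord: "H.ord g = 2 \<longleftrightarrow> p = 2 \<and> \<alpha> = 0" .
  show ?thesis
  proof (cases "p = 2 \<and> \<alpha> = 0")
    case True
    then have "\<beta> \<noteq> 0" using u1 by (auto simp: one_eq_upp)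
    then show ?thesis using involutions[of \<beta>] True u ord cls by auto
  next
    case False
    then show ?thesis using irreducible[OF u u1 False] unfolding ord cls by blast
  qed
qed

end

section \<open>Change of basis from the antidiagonal to the standard form\<close>

context unitary_field begin

definition ct :: "'a mat \<Rightarrow> 'a mat" where "ct = conj_transpose q"

lemma ct_m3 [simp]:
  "ct (m3 a b c d e f g h i) = m3 (cj a) (cj d) (cj g) (cj b) (cj e) (cj h) (cj c) (cj f) (cj i)"
  by (simp add: ct_def conj_transpose_m3 cj_def)

lemma ct_carrier [simp]: "A \<in> carrier_mat 3 3 \<Longrightarrow> ct A \<in> carrier_mat 3 3"
  by (elim m3_cases) simp

lemma ct_mult: "A \<in> carrier_mat 3 3 \<Longrightarrow> B \<in> carrier_mat 3 3 \<Longrightarrow> ct (A * B) = ct B * ct A"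
  by (elim m3_cases) (simp add: algebra_simps)

definition antidiag :: "'a mat" where "antidiag = m3 0 0 1 0 1 0 1 0 0"

lemma antidiag_carrier [simp]: "antidiag \<in> carrier_mat 3 3" by (simp add: antidiag_def)

lemma adj_eq: "A \<in> carrier_mat 3 3 \<Longrightarrow> adj A = antidiag * ct A * antidiag"
  by (elim m3_cases) (simp add: antidiag_def)

lemma antidiag_sq: "antidiag * antidiag = 1\<^sub>m 3" by (simp add: antidiag_def one_mat_3)

lemma mat3_assoc:
  "\<lbrakk>A \<in> carrier_mat 3 3; B \<in> carrier_mat 3 3; C \<in> carrier_mat 3 3\<rbrakk> \<Longrightarrow> A * B * C = A * (B * C :: 'a mat)"
  by (rule assoc_mult_mat)

lemma mat3_cancel:
  "\<lbrakk>P \<in> carrier_mat 3 3; Q \<in> carrier_mat 3 3; X \<in> carrier_mat 3 3; P * Q = 1\<^sub>m 3\<rbrakk> \<Longrightarrow> P * (Q * X) = (X :: 'a mat)"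
  by (simp flip: mat3_assoc)

lemma mat3_mult_carrier [simp]:
  "A \<in> carrier_mat 3 3 \<Longrightarrow> B \<in> carrier_mat 3 3 \<Longrightarrow> A * B \<in> carrier_mat 3 3"
  by (rule mult_carrier_mat)

text \<open>The outer rows of \<open>P\<close> span two distinct singular lines of a coordinate
  plane, scaled to pair to 1 (\<open>w\<close> is the pairing before scaling); the middle row is a
  unit vector orthogonal to that plane.\<close>

lemma hyperbolic_basis:
  obtains P Q where "P \<in> carrier_mat 3 3" "Q \<in> carrier_mat 3 3" "P * Q = 1\<^sub>m 3" "Q * P = 1\<^sub>m 3"
    "P * ct P = antidiag"
proof -
  obtain c where c: "c * cj c = - 1" using norm_surj[of "- 1"] by auto
  obtain y where y: "cj y \<noteq> y" using exists_not_fixed by blast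
  then have y0: "y \<noteq> 0" by auto
  \<comment> \<open>Multiplying by \<open>cj y / y\<close>, which has norm 1 and is not 1, gives a
    second solution of the norm equation.\<close>
  define c' where "c' = c * (cj y / y)"
  have c0: "c \<noteq> 0" using c by auto
  have c': "c' * cj c' = - 1" using c y0 by (simp add: c'_def field_simps)
  define w where "w = 1 + c' * cj c"
  have "c * w = c - c' * (- (c * cj c))" by (simp add: w_def algebra_simps)
  then have "c * w = c - c'" by (simp add: c)
  moreover have "c \<noteq> c'" using y y0 c0 by (simp add: c'_def field_simps)
  ultimately have w: "w \<noteq> 0" by auto
  define P where "P = m3 1 c 0 0 0 1 (1 / w) (c' / w) 0"
  have cw: "1 + cj c' * c = cj w" by (simp add: w_def)
  have cw0: "cj w \<noteq> 0" using w by simp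
  have P: "P * ct P = antidiag"
  proof -
    have "1 + c * cj c = 0" "1 + c' * cj c' = 0" using c c' by simp_all
    moreover have "1 / cj w + c * cj c' / cj w = (1 + cj c' * c) / cj w"
      by (simp add: add_divide_distrib mult.commute)
    then have "1 / cj w + c * cj c' / cj w = 1" unfolding cw using cw0 by simp
    moreover have "1 / w + c' * cj c / w = (1 + c' * cj c) / w" by (simp add: add_divide_distrib)
    then have "1 / w + c' * cj c / w = 1" unfolding w_def[symmetric] using w by simp
    moreover have "1 / (w * cj w) + c' * cj c' / (w * cj w) = (1 + c' * cj c') / (w * cj w)"
      by (simp add: add_divide_distrib)
    ultimately show ?thesis using w by (simp add: P_def antidiag_def)
  qed
  have Pc: "P \<in> carrier_mat 3 3" by (simp add: P_def)
  define Q where "Q = ct P * antidiag"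
  have Q: "Q \<in> carrier_mat 3 3" using Pc by (simp add: Q_def)
  have "P * Q = 1\<^sub>m 3" using P Pc by (simp add: Q_def antidiag_sq flip: mat3_assoc)
  moreover from this have "Q * P = 1\<^sub>m 3" by (rule mat_mult_left_right_inverse[OF Pc Q])
  ultimately show thesis using that Pc Q P by blast
qed

lemma SU3_carrier_iff:
  "A \<in> carrier (SU3 q) \<longleftrightarrow> A \<in> carrier_mat 3 3 \<and> A * ct A = 1\<^sub>m 3 \<and> det A = (1 :: 'a)"
  by (simp add: SU3_def SU3_carrier_def ct_def)

lemma SU3_simps [simp]: "x \<otimes>\<^bsub>SU3 q\<^esub> y = x * y" "\<one>\<^bsub>SU3 q\<^esub> = 1\<^sub>m 3"
  by (simp_all add: SU3_def)

lemma SUJ_iff_antidiag: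
  assumes A: "A \<in> carrier_mat 3 3"
  shows "A \<in> carrier SUJ \<longleftrightarrow> A * antidiag * ct A = antidiag \<and> det A = 1"
proof -
  have "A * adj A = A * antidiag * ct A * antidiag"
    using A by (simp add: adj_eq mat3_assoc)
  moreover have "X * antidiag = 1\<^sub>m 3 \<longleftrightarrow> X = antidiag" if "X \<in> carrier_mat 3 3" for X
  proof
    assume "X * antidiag = 1\<^sub>m 3"
    then have "X * antidiag * antidiag = antidiag"
      using left_mult_one_mat[OF antidiag_carrier] by simp
    then show "X = antidiag" using that by (simp add: mat3_assoc antidiag_sq)
  qed (simp add: antidiag_sq)
  ultimately show ?thesis using A by (simp add: SUJ_carrier)
qed

text \<open>As \<open>P * ct P\<close> is the Gram matrix \<open>antidiag\<close>, conjugation by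
  \<open>P\<close> exchanges the two Hermitian forms; \<phi> is the inverse of \<psi>.\<close>

lemma iso_SU3:
  obtains \<psi> where "\<psi> \<in> hom SUJ (SU3 q :: 'a mat monoid)" "\<psi> ` carrier SUJ = carrier (SU3 q)"
    "inj_on \<psi> (carrier SUJ)" "\<psi> (1\<^sub>m 3) = 1\<^sub>m 3"
proof -
  obtain P Q where PQ: "P \<in> carrier_mat 3 3" "Q \<in> carrier_mat 3 3" "P * Q = 1\<^sub>m 3" "Q * P = 1\<^sub>m 3"
    "P * ct P = antidiag" using hyperbolic_basis .
  define \<psi> where "\<psi> = (\<lambda>A. Q * A * P)"
  define \<phi> where "\<phi> = (\<lambda>A. P * A * Q)"
  have one: "ct (1\<^sub>m 3) = 1\<^sub>m 3" by (simp add: one_mat_3)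
  have ctPQ: "ct P * ct Q = 1\<^sub>m 3" "ct Q * ct P = 1\<^sub>m 3"
    using ct_mult[OF PQ(2,1)] ct_mult[OF PQ(1,2)] PQ one by simp_all
  have canc: "P * (Q * X) = X" "Q * (P * X) = X" "ct P * (ct Q * X) = X" "ct Q * (ct P * X) = X"
    if "X \<in> carrier_mat 3 3" for X
    using that PQ ctPQ by (auto intro: mat3_cancel)
  have PctP: "P * (ct P * X) = antidiag * X" if "X \<in> carrier_mat 3 3" for X
    using that PQ by (simp flip: mat3_assoc)
  have QJ: "Q * (antidiag * ct Q) = 1\<^sub>m 3"
    using PQ ctPQ canc by (simp add: mat3_assoc flip: PQ(5))
  have det: "det (Q * A * P) = det A" "det (P * A * Q) = det A" if "A \<in> carrier_mat 3 3" for A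
  proof -
    have "det Q * det P = 1" using PQ det_mult[of Q 3 P] by simp
    then show "det (Q * A * P) = det A" "det (P * A * Q) = det A"
      using that PQ by (simp_all add: det_mult[of _ 3] mult.commute mult.left_commute)
  qed
  have into: "\<psi> A \<in> carrier (SU3 q)" if A: "A \<in> carrier SUJ" for A
  proof -
    have Ac: "A \<in> carrier_mat 3 3" using SUJ_D[OF A] by simp
    have AJ: "A * (antidiag * ct A) = antidiag" "det A = 1"
      using A SUJ_iff_antidiag[OF Ac] Ac by (simp_all add: mat3_assoc)
    have AJX: "A * (antidiag * (ct A * X)) = antidiag * X" if "X \<in> carrier_mat 3 3" for X
      using that Ac AJ by (simp flip: mat3_assoc)
    have "\<psi> A * ct (\<psi> A) = Q * (A * (P * (ct P * (ct A * ct Q))))"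
      using Ac PQ by (simp add: \<psi>_def ct_mult mat3_assoc)
    also have "\<dots> = 1\<^sub>m 3" using Ac PQ by (simp add: PctP AJX QJ)
    finally show ?thesis using Ac PQ det AJ by (simp add: SU3_carrier_iff \<psi>_def)
  qed
  have into_SUJ: "\<phi> A \<in> carrier SUJ" if A: "A \<in> carrier (SU3 q)" for A
  proof -
    have Ac: "A \<in> carrier_mat 3 3" "A * ct A = 1\<^sub>m 3" "det A = 1" using A by (simp_all add: SU3_carrier_iff)
    have AX: "A * (ct A * X) = X" if "X \<in> carrier_mat 3 3" for X using that Ac by (intro mat3_cancel) auto
    have "\<phi> A * antidiag * ct (\<phi> A) = P * (A * (Q * (antidiag * (ct Q * (ct A * ct P)))))"
      using Ac PQ by (simp add: \<phi>_def ct_mult mat3_assoc)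
    also have "\<dots> = P * (A * (Q * (antidiag * ct Q) * (ct A * ct P)))"
      using Ac PQ by (simp add: mat3_assoc)
    also have "\<dots> = antidiag" using Ac(1) PQ by (simp add: QJ AX left_mult_one_mat[of _ 3 3])
    finally show ?thesis using Ac PQ det by (simp add: SUJ_iff_antidiag \<phi>_def)
  qed
  have inv: "\<phi> (\<psi> A) = A" "\<psi> (\<phi> A) = A" if "A \<in> carrier_mat 3 3" for A
    using that PQ by (simp_all add: \<phi>_def \<psi>_def mat3_assoc canc)
  show thesis
  proof (rule that)
    show "\<psi> \<in> hom SUJ (SU3 q)"
    proof (rule homI)
      fix x y assume "x \<in> carrier SUJ" "y \<in> carrier SUJ"
      then have "x \<in> carrier_mat 3 3" "y \<in> carrier_mat 3 3" using SUJ_D by auto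
      then show "\<psi> (x \<otimes>\<^bsub>SUJ\<^esub> y) = \<psi> x \<otimes>\<^bsub>SU3 q\<^esub> \<psi> y"
        using PQ by (simp add: \<psi>_def mat3_assoc canc)
    qed (rule into)
    show "\<psi> ` carrier SUJ = carrier (SU3 q)"
    proof (intro equalityI subsetI)
      fix A :: "'a mat" assume A: "A \<in> carrier (SU3 q)"
      then have "\<psi> (\<phi> A) = A" using inv by (simp add: SU3_carrier_iff)
      then show "A \<in> \<psi> ` carrier SUJ" using into_SUJ[OF A] by (metis imageI)
    qed (use into in auto)
    show "inj_on \<psi> (carrier SUJ)" using inv(1) SUJ_D(1) by (metis inj_on_inverseI)
    show "\<psi> (1\<^sub>m 3) = 1\<^sub>m 3" using PQ by (simp add: \<psi>_def)
  qed
qed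

lemma group_SU3: "group (SU3 q :: 'a mat monoid)"
proof -
  obtain \<psi> where psi: "\<psi> \<in> hom SUJ (SU3 q :: 'a mat monoid)"
    "\<psi> ` carrier SUJ = carrier (SU3 q)" "\<psi> (1\<^sub>m 3) = 1\<^sub>m 3" using iso_SU3 by blast
  have "(SU3 q)\<lparr>carrier := \<psi> ` carrier SUJ, one := \<psi> \<one>\<^bsub>SUJ\<^esub>\<rparr> = (SU3 q :: 'a mat monoid)"
    using psi by (simp add: SU3_def)
  then show ?thesis using G.hom_imp_img_group[OF psi(1)] by simp
qed

end

section \<open>The centre, and the two groups \<open>SU3 q\<close> and \<open>PSU3 q\<close>\<close>

lemma (in group) grp_center_iff:
  "z \<in> grp_center G \<longleftrightarrow> z \<in> carrier G \<and> (\<forall>h\<in>carrier G. conj_by h z = z)"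
  using conj_by_eq_self_iff unfolding grp_center_def by auto

lemma (in group) normal_grp_center: "grp_center G \<lhd> G"
proof (rule normal_invI)
  show "subgroup (grp_center G) G"
  proof (rule subgroupI)
    have "\<one> \<in> grp_center G" by (simp add: grp_center_iff conj_by_def)
    then show "grp_center G \<noteq> {}" by blast
    fix a assume a: "a \<in> grp_center G"
    have "conj_by h (inv a) = inv (conj_by h a)" if "h \<in> carrier G" for h
      using that a by (simp add: conj_by_def grp_center_iff inv_mult_group m_assoc)
    then show "inv a \<in> grp_center G" using a by (simp add: grp_center_iff)
  qed (auto simp: grp_center_iff)
next
  fix x h assume "x \<in> carrier G" "h \<in> grp_center G"
  then show "x \<otimes> h \<otimes> inv x \<in> grp_center G"
    by (simp add: grp_center_iff flip: conj_by_def)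
qed

theorem theorem4p13:
  fixes p q :: nat
  assumes "finite (UNIV :: 'a::field set)"
    and "prime p" and "\<exists>n. n \<ge> 1 \<and> q = p ^ n" and "q \<noteq> 2"
    and "card (UNIV :: 'a set) = q ^ 2"
  shows "(\<forall>g \<in> carrier (SU3 q :: 'a mat monoid).
            g \<noteq> \<one>\<^bsub>SU3 q\<^esub> \<and> (\<exists>k. group.ord (SU3 q) g = p ^ k) \<longrightarrow>
              (killing_irreducible (SU3 q) (conj_class (SU3 q) g)
                 \<longleftrightarrow> group.ord (SU3 q) g \<noteq> 2)
            \<and> (group.ord (SU3 q) g = 2
                 \<longrightarrow> killing_nondegenerate (SU3 q) (conj_class (SU3 q) g)))
       \<and> (\<forall>g \<in> carrier (PSU3 q :: 'a mat set monoid).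
            g \<noteq> \<one>\<^bsub>PSU3 q\<^esub> \<and> (\<exists>k. group.ord (PSU3 q) g = p ^ k) \<longrightarrow>
              (killing_irreducible (PSU3 q) (conj_class (PSU3 q) g)
                 \<longleftrightarrow> group.ord (PSU3 q) g \<noteq> 2)
            \<and> (group.ord (PSU3 q) g = 2
                 \<longrightarrow> killing_nondegenerate (PSU3 q) (conj_class (PSU3 q) g)))"
proof -
  interpret unitary_field p q "TYPE('a)" by unfold_locales (use assms in auto)
  let ?S = "SU3 q :: 'a mat monoid"
  interpret S: group ?S by (rule group_SU3)
  obtain \<psi> where psi: "\<psi> \<in> hom SUJ ?S" "\<psi> ` carrier SUJ = carrier ?S"
    "inj_on \<psi> (carrier SUJ)" "\<psi> (1\<^sub>m 3) = 1\<^sub>m 3" using iso_SU3 .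
  have hm: "\<psi> (x * y) = \<psi> x * \<psi> y" if "x \<in> carrier SUJ" "y \<in> carrier SUJ" for x y
    using hom_mult[OF psi(1) that] by simp
  interpret SU: unitary_quotient p q "TYPE('a)" ?S \<psi>
  proof unfold_locales
    fix z x :: "'a mat" assume zx: "z \<in> carrier SUJ" "\<psi> z = \<one>\<^bsub>?S\<^esub>" "x \<in> carrier SUJ"
    then have "\<psi> z = \<psi> (1\<^sub>m 3)" using psi(4) by simp
    then have "z = 1\<^sub>m 3" using inj_onD[OF psi(3)] zx(1) G.one_closed by simp
    then show "z * x = x * z" using SUJ_D(1)[OF zx(3)] by simp
  qed (use psi in auto)
  interpret Z: normal "grp_center ?S" ?S by (rule S.normal_grp_center)
  let ?Z = "grp_center ?S"
  let ?\<pi> = "\<lambda>a. ?Z #>\<^bsub>?S\<^esub> a"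
  interpret P: group "PSU3 q :: 'a mat set monoid"
    unfolding PSU3_def by (rule Z.factorgroup_is_group)
  interpret PSU: unitary_quotient p q "TYPE('a)" "PSU3 q" "?\<pi> \<circ> \<psi>"
  proof unfold_locales
    show "?\<pi> \<circ> \<psi> \<in> hom SUJ (PSU3 q)"
      using hom_compose[OF psi(1) Z.r_coset_hom_Mod] by (simp add: PSU3_def)
    have "carrier (PSU3 q :: 'a mat set monoid) = ?\<pi> ` carrier ?S"
      by (auto simp: PSU3_def FactGroup_def RCOSETS_def)
    then show "(?\<pi> \<circ> \<psi>) ` carrier SUJ = carrier (PSU3 q)" by (simp only: psi(2) flip: image_comp)
    fix z x :: "'a mat" assume zx: "z \<in> carrier SUJ" "(?\<pi> \<circ> \<psi>) z = \<one>\<^bsub>PSU3 q\<^esub>" "x \<in> carrier SUJ"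
    have zS: "\<psi> z \<in> carrier ?S" "\<psi> x \<in> carrier ?S" using zx psi(2) by auto
    \<comment> \<open>A trivial coset puts \<open>\<psi> z\<close> in the centre of
      \<open>SU3 q\<close>; injectivity of \<psi> carries the commutation back to
      \<open>SUJ\<close>.\<close>
    have "?Z #>\<^bsub>?S\<^esub> \<psi> z = ?Z" using zx(2) by (simp add: PSU3_def FactGroup_def)
    then have "\<psi> z \<in> ?Z" using S.rcos_self[OF zS(1) Z.subgroup_axioms] by simp
    then have "\<psi> z * \<psi> x = \<psi> x * \<psi> z" using zS(2) unfolding grp_center_def by auto
    then have "\<psi> (z * x) = \<psi> (x * z)" using zx hm by simp
    then show "z * x = x * z" using inj_onD[OF psi(3)] zx SUJ_mult by blast
  qed
  show ?thesis
    using SU.killing_unipotent_class PSU.killing_unipotent_class by blast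
qed

end
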